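(* Let $(M,g)$ be a Riemannian manifold. The following statements hold true: (i) For every module SRF $(M,g,\mathcal{F})$ with $\mathcal{F}$ finitely generated, there exists an almost Lie algebroid $(A,\rho,[\cdot,\cdot]_A)$ over $M$ equipped with a connection $\nabla\colon\Gamma(A)\to\Gamma(T^*M\otimes A)$ such that $\mathcal{F}=\rho(\Gamma_c(A))$ and ${}^A\nabla g=0$, where ${}^A\nabla$ is the $A$-connection induced by $\nabla$. (ii) Let $(A,\rho,[\cdot,\cdot]_A)$ be an almost Lie algebroid over $(M,g)$ such that the triple $(M,g,\mathcal{F}:=\rho(\Gamma_c(A)))$ is a module SRF. Then there exists a connection $\nabla$ on $A$ such that ${}^A\nabla g=0$.
   Context: A singular foliation (SF) on a smooth manifold $M$ is a $C^\infty(M)$-submodule $\mathcal{F}$ of the compactly supported vector fields $\mathfrak{X}_c(M)$ that is closed under the Lie bracket and locally finitely generated: every $q\in M$ has an open neighborhood $U$ such that $\{X\in\mathcal{F}:\mathrm{supp}(X)\subset U\}=\langle X_1,\dots,X_N\rangle_{C_c^\infty(U)}$ for finitely many $X_a\in\mathfrak{X}(U)$. $\mathcal{F}$ is finitely generated if $\mathcal{F}=\langle X_1,\dots,X_r\rangle_{C_c^\infty(M)}$ for finitely many $X_a\in\mathfrak{X}(M)$. $(M,g,\mathcal{F})$ is a module SRF if $\mathcal{L}_Xg\in\Omega^1(M)\odot g_\flat(\mathcal{F})$ for every $X\in\mathcal{F}$, where $g_\flat(Y)=g(Y,\cdot)$, $\odot$ is the symmetric tensor product, and the right-hand side consists of finite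 sums of products. An almost Lie algebroid $(A,\rho,[\cdot,\cdot]_A)$ over $M$ is a vector bundle $A\to M$ with a vector bundle morphism $\rho\colon A\to TM$ over the identity (the anchor) and an ($\mathbb{R}$-bilinear) skew-symmetric bracket $[\cdot,\cdot]_A$ on $\Gamma(A)$ such that $\rho([s,s']_A)=[\rho(s),\rho(s')]$ and $[s,fs']_A=(\rho(s)\cdot f)s'+f[s,s']_A$ for $s,s'\in\Gamma(A)$, $f\in C^\infty(M)$ (no Jacobi identity required). $\Gamma_c(A)$ denotes compactly supported sections. An ordinary connection $\nabla$ on $A$ induces the $A$-connection ${}^A\nabla$ on $TM$ by ${}^A\nabla_sX:=\mathcal{L}_{\rho(s)}X+\rho(\nabla_Xs)$ for $s\in\Gamma(A)$, $X\in\mathfrak{X}(M)$, extended to all tensor powers of $TM$ and $T^*M$ by ${}^A\nabla_sf=\rho(s)\cdot f$ on functions, the Leibniz rule and commutation with contractions; ${}^A\nabla g=0$ means ${}^A\nabla_sg=0$ for all $s\in\Gamma(A)$. *)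

theory Defs
  imports "HOL-Analysis.Analysis" "HOL-Analysis.Finite_Function_Topology"
begin

section \<open>Smooth manifolds\<close>

(* S is always an open subset of a finite-dimensional space below; there, continuity of all
   directional derivatives x |-> f' x v is the same as continuity of the Frechet derivative. *)
primrec Ck_on :: "nat \<Rightarrow> 'a::real_normed_vector set \<Rightarrow> ('a \<Rightarrow> 'b::real_normed_vector) \<Rightarrow> bool" where
  "Ck_on 0 S f \<longleftrightarrow> continuous_on S f"
| "Ck_on (Suc k) S f \<longleftrightarrow>
     (\<exists>f'. (\<forall>x\<in>S. (f has_derivative f' x) (at x)) \<and> (\<forall>v. Ck_on k S (\<lambda>x. f' x v)))"

definition smooth_on :: "'a::real_normed_vector set \<Rightarrow> ('a \<Rightarrow> 'b::real_normed_vector) \<Rightarrow> bool" where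
  "smooth_on S f \<longleftrightarrow> (\<forall>k. Ck_on k S f)"

(* A chart is a domain together with a coordinate map, whose values off the domain are irrelevant.
   The manifold is the whole type 'm; being Hausdorff and second countable is imposed through the
   classes t2_space and second_countable_topology.
   The model space 'e has sort {real_inner, heine_borel}: by Riesz's theorem these are exactly the
   finite-dimensional Euclidean spaces, including dimension 0 (which euclidean_space excludes). *)
type_synonym ('m, 'e) chart = "'m set \<times> ('m \<Rightarrow> 'e)"

(* The atlas need not be maximal: every notion below depends only on the smooth structure that
   it generates. *)
definition smooth_atlas ::
  "('m::{t2_space,second_countable_topology}, 'e::{real_inner,heine_borel}) chart set \<Rightarrow> bool" where
  "smooth_atlas At \<longleftrightarrow>
     (\<Union>(U, \<phi>)\<in>At. U) = UNIV \<and>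
     (\<forall>(U, \<phi>)\<in>At. open U \<and> open (\<phi> ` U) \<and> homeomorphism U (\<phi> ` U) \<phi> (inv_into U \<phi>)) \<and>
     (\<forall>(U, \<phi>)\<in>At. \<forall>(V, \<psi>)\<in>At. smooth_on (\<phi> ` (U \<inter> V)) (\<psi> \<circ> inv_into U \<phi>))"

definition smooth_fun ::
  "('m::topological_space, 'e::real_normed_vector) chart set \<Rightarrow> 'm set \<Rightarrow> ('m \<Rightarrow> real) \<Rightarrow> bool" where
  "smooth_fun At U f \<longleftrightarrow> (\<forall>(V, \<phi>)\<in>At. smooth_on (\<phi> ` (U \<inter> V)) (f \<circ> inv_into V \<phi>))"

definition C_inf :: "('m::topological_space, 'e::real_normed_vector) chart set \<Rightarrow> ('m \<Rightarrow> real) set" where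
  "C_inf At = {f. smooth_fun At UNIV f}"

(* Smooth functions with compact support contained in the open set U, extended by 0 to M. *)
definition C_inf_c ::
  "('m::topological_space, 'e::real_normed_vector) chart set \<Rightarrow> 'm set \<Rightarrow> ('m \<Rightarrow> real) set" where
  "C_inf_c At U = {f \<in> C_inf At. compact (closure {p. f p \<noteq> 0}) \<and> closure {p. f p \<noteq> 0} \<subseteq> U}"

section \<open>Vector fields, one-forms, metrics\<close>

(* Tangent vectors at p are the derivations at p of the algebra of smooth functions on M.
   The value 0 on non-smooth functions is only a normalisation making equality extensional. *)
type_synonym 'm tvec = "('m \<Rightarrow> real) \<Rightarrow> real"
type_synonym 'm vfield = "'m \<Rightarrow> 'm tvec"

definition tangent_space ::
  "('m::topological_space, 'e::real_normed_vector) chart set \<Rightarrow> 'm \<Rightarrow> 'm tvec set" where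
  "tangent_space At p = {v.
     (\<forall>f. f \<notin> C_inf At \<longrightarrow> v f = 0) \<and>
     (\<forall>f\<in>C_inf At. \<forall>h\<in>C_inf At. \<forall>a b. v (\<lambda>q. a * f q + b * h q) = a * v f + b * v h) \<and>
     (\<forall>f\<in>C_inf At. \<forall>h\<in>C_inf At. v (\<lambda>q. f q * h q) = v f * h p + f p * v h)}"

(* Smooth vector fields on the open set U (values off U are unconstrained). *)
definition vfields ::
  "('m::topological_space, 'e::real_normed_vector) chart set \<Rightarrow> 'm set \<Rightarrow> 'm vfield set" where
  "vfields At U = {X. (\<forall>p\<in>U. X p \<in> tangent_space At p) \<and>
                      (\<forall>f\<in>C_inf At. smooth_fun At U (\<lambda>p. X p f))}"

definition vsupp :: "'m::topological_space vfield \<Rightarrow> 'm set" where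
  "vsupp X = closure {p. X p \<noteq> (\<lambda>f. 0)}"

definition vfields_c ::
  "('m::topological_space, 'e::real_normed_vector) chart set \<Rightarrow> 'm vfield set" where
  "vfields_c At = {X \<in> vfields At UNIV. compact (vsupp X)}"

definition lie_bracket :: "'m vfield \<Rightarrow> 'm vfield \<Rightarrow> 'm vfield" where
  "lie_bracket X Y = (\<lambda>p f. X p (\<lambda>q. Y q f) - Y p (\<lambda>q. X q f))"

definition tangent_linear ::
  "('m::topological_space, 'e::real_normed_vector) chart set \<Rightarrow> 'm \<Rightarrow>
   ('m tvec \<Rightarrow> 'w::real_vector) \<Rightarrow> bool" where
  "tangent_linear At p L \<longleftrightarrow>
     (\<forall>v\<in>tangent_space At p. \<forall>w\<in>tangent_space At p. \<forall>a b.
        L (\<lambda>f. a * v f + b * w f) = a *\<^sub>R L v + b *\<^sub>R L w)"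

type_synonym 'm form = "'m \<Rightarrow> 'm tvec \<Rightarrow> real"

(* As usual for tensor fields, smoothness means that contraction with smooth vector fields
   yields smooth functions. *)
definition one_form ::
  "('m::topological_space, 'e::real_normed_vector) chart set \<Rightarrow> 'm form \<Rightarrow> bool" where
  "one_form At \<omega> \<longleftrightarrow> (\<forall>p. tangent_linear At p (\<omega> p)) \<and>
     (\<forall>X\<in>vfields At UNIV. (\<lambda>p. \<omega> p (X p)) \<in> C_inf At)"

type_synonym 'm metric = "'m \<Rightarrow> 'm tvec \<Rightarrow> 'm tvec \<Rightarrow> real"

definition riemannian_metric ::
  "('m::topological_space, 'e::real_normed_vector) chart set \<Rightarrow> 'm metric \<Rightarrow> bool" where
  "riemannian_metric At g \<longleftrightarrow>
     (\<forall>p. \<forall>v\<in>tangent_space At p.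
        tangent_linear At p (g p v) \<and>
        (\<forall>w\<in>tangent_space At p. g p v w = g p w v) \<and>
        (v \<noteq> (\<lambda>f. 0) \<longrightarrow> g p v v > 0)) \<and>
     (\<forall>X\<in>vfields At UNIV. \<forall>Y\<in>vfields At UNIV. (\<lambda>p. g p (X p) (Y p)) \<in> C_inf At)"

(* Covariant 2-tensor fields, represented by their values T(Y,Z) on smooth vector fields Y, Z. *)
type_synonym 'm cov2 = "'m vfield \<Rightarrow> 'm vfield \<Rightarrow> 'm \<Rightarrow> real"

definition lie_derivative_metric :: "'m vfield \<Rightarrow> 'm metric \<Rightarrow> 'm cov2" where
  "lie_derivative_metric X g = (\<lambda>Y Z p.
     X p (\<lambda>q. g q (Y q) (Z q)) - g p (lie_bracket X Y p) (Z p) - g p (Y p) (lie_bracket X Z p))"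

definition flat :: "'m metric \<Rightarrow> 'm vfield \<Rightarrow> 'm form" where
  "flat g Y = (\<lambda>p v. g p (Y p) v)"

(* Convention without the factor 1/2; the set of sums of such products is the same either way. *)
definition sym_prod :: "'m form \<Rightarrow> 'm form \<Rightarrow> 'm cov2" where
  "sym_prod \<omega> \<theta> = (\<lambda>Y Z p. \<omega> p (Y p) * \<theta> p (Z p) + \<omega> p (Z p) * \<theta> p (Y p))"

section \<open>Singular foliations and module singular Riemannian foliations\<close>

(* The span of X 0, ..., X (N-1), fields on the open set U, over C_inf_c(U); the products f a * X a
   are extended by 0 to M. *)
definition span_c ::
  "('m::topological_space, 'e::real_normed_vector) chart set \<Rightarrow> 'm set \<Rightarrow> nat \<Rightarrow>
   (nat \<Rightarrow> 'm vfield) \<Rightarrow> 'm vfield set" where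
  "span_c At U N X = {\<lambda>p h. \<Sum>a<N. f a p * X a p h | f. \<forall>a<N. f a \<in> C_inf_c At U}"

definition singular_foliation ::
  "('m::topological_space, 'e::real_normed_vector) chart set \<Rightarrow> 'm vfield set \<Rightarrow> bool" where
  "singular_foliation At F \<longleftrightarrow>
     F \<subseteq> vfields_c At \<and>
     (\<lambda>p f. 0) \<in> F \<and>
     (\<forall>X\<in>F. \<forall>Y\<in>F. (\<lambda>p f. X p f + Y p f) \<in> F) \<and>
     (\<forall>h\<in>C_inf At. \<forall>X\<in>F. (\<lambda>p f. h p * X p f) \<in> F) \<and>
     (\<forall>X\<in>F. \<forall>Y\<in>F. lie_bracket X Y \<in> F) \<and>
     (\<forall>q. \<exists>U N X. open U \<and> q \<in> U \<and> (\<forall>a<N. X a \<in> vfields At U) \<and>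
            {Y \<in> F. vsupp Y \<subseteq> U} = span_c At U N X)"

definition finitely_generated ::
  "('m::topological_space, 'e::real_normed_vector) chart set \<Rightarrow> 'm vfield set \<Rightarrow> bool" where
  "finitely_generated At F \<longleftrightarrow>
     (\<exists>r X. (\<forall>a<r. X a \<in> vfields At UNIV) \<and> F = span_c At UNIV r X)"

definition module_SRF ::
  "('m::topological_space, 'e::real_normed_vector) chart set \<Rightarrow> 'm metric \<Rightarrow> 'm vfield set \<Rightarrow> bool" where
  "module_SRF At g F \<longleftrightarrow>
     riemannian_metric At g \<and> singular_foliation At F \<and>
     (\<forall>X\<in>F. \<exists>(N::nat) \<omega> V. (\<forall>i<N. one_form At (\<omega> i) \<and> V i \<in> F) \<and>
        (\<forall>Y\<in>vfields At UNIV. \<forall>Z\<in>vfields At UNIV. \<forall>p.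
           lie_derivative_metric X g Y Z p = (\<Sum>i<N. sym_prod (\<omega> i) (flat g (V i)) Y Z p)))"

section \<open>Vector bundles and almost Lie algebroids\<close>

definition coord_space :: "nat \<Rightarrow> (nat \<Rightarrow> real) set" where
  "coord_space k = {c. \<forall>i\<ge>k. c i = 0}"

(* The fibre over p is a linear subspace of an ambient vector space 'v; fibres over different
   points are not related through 'v (the total space is the disjoint union of the fibres), so
   every vector bundle is of this form up to isomorphism, provided that dim 'v is at least the
   ranks; (nat, real) poly_mapping, i.e. R^\<infinity>, accommodates all of them. A local trivialisation (U, k, \<phi>) identifies the fibre over p \<in> U with R^k through \<phi> p.
   The rank may vary between connected components. *)
record ('m, 'v) vbundle =
  fibre :: "'m \<Rightarrow> 'v set"
  trivs :: "('m set \<times> nat \<times> ('m \<Rightarrow> 'v \<Rightarrow> nat \<Rightarrow> real)) set"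

definition vector_bundle ::
  "('m::topological_space, 'e::real_normed_vector) chart set \<Rightarrow> ('m, 'v::real_vector) vbundle \<Rightarrow> bool" where
  "vector_bundle At A \<longleftrightarrow>
     (\<forall>p. subspace (fibre A p)) \<and>
     (\<Union>(U, k, \<phi>)\<in>trivs A. U) = UNIV \<and>
     (\<forall>(U, k, \<phi>)\<in>trivs A. open U \<and>
        (\<forall>p\<in>U. bij_betw (\<phi> p) (fibre A p) (coord_space k) \<and>
           (\<forall>x\<in>fibre A p. \<forall>y\<in>fibre A p. \<forall>a b i.
              \<phi> p (a *\<^sub>R x + b *\<^sub>R y) i = a * \<phi> p x i + b * \<phi> p y i))) \<and>
     (\<forall>(U, k, \<phi>)\<in>trivs A. \<forall>(V, l, \<psi>)\<in>trivs A. \<exists>\<tau>.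
        (\<forall>j<l. \<forall>i<k. smooth_fun At (U \<inter> V) (\<tau> j i)) \<and>
        (\<forall>p\<in>U \<inter> V. \<forall>x\<in>fibre A p. \<forall>j<l. \<psi> p x j = (\<Sum>i<k. \<tau> j i p * \<phi> p x i)))"

definition sections ::
  "('m::topological_space, 'e::real_normed_vector) chart set \<Rightarrow> ('m, 'v::real_vector) vbundle \<Rightarrow>
   ('m \<Rightarrow> 'v) set" where
  "sections At A = {s. (\<forall>p. s p \<in> fibre A p) \<and>
     (\<forall>(U, k, \<phi>)\<in>trivs A. \<forall>i<k. smooth_fun At U (\<lambda>p. \<phi> p (s p) i))}"

definition sections_c ::
  "('m::topological_space, 'e::real_normed_vector) chart set \<Rightarrow> ('m, 'v::real_vector) vbundle \<Rightarrow>
   ('m \<Rightarrow> 'v) set" where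
  "sections_c At A = {s \<in> sections At A. compact (closure {p. s p \<noteq> 0})}"

definition anchor_on :: "('m \<Rightarrow> 'v \<Rightarrow> 'm tvec) \<Rightarrow> ('m \<Rightarrow> 'v) \<Rightarrow> 'm vfield" where
  "anchor_on \<rho> s = (\<lambda>p. \<rho> p (s p))"

(* Vector bundle morphisms A \<rightarrow> TM over the identity: fibrewise linear, and in every local
   trivialisation (p, c) |-> sum of c i * X i p with X i smooth vector fields on U. *)
definition anchor_map ::
  "('m::topological_space, 'e::real_normed_vector) chart set \<Rightarrow> ('m, 'v::real_vector) vbundle \<Rightarrow>
   ('m \<Rightarrow> 'v \<Rightarrow> 'm tvec) \<Rightarrow> bool" where
  "anchor_map At A \<rho> \<longleftrightarrow>
     (\<forall>p. \<forall>x\<in>fibre A p. \<rho> p x \<in> tangent_space At p \<and>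
        (\<forall>y\<in>fibre A p. \<forall>a b. \<rho> p (a *\<^sub>R x + b *\<^sub>R y) = (\<lambda>f. a * \<rho> p x f + b * \<rho> p y f))) \<and>
     (\<forall>(U, k, \<phi>)\<in>trivs A. \<exists>X. (\<forall>i<k. X i \<in> vfields At U) \<and>
        (\<forall>p\<in>U. \<forall>x\<in>fibre A p. \<rho> p x = (\<lambda>f. \<Sum>i<k. \<phi> p x i * X i p f)))"

definition almost_lie_algebroid ::
  "('m::topological_space, 'e::real_normed_vector) chart set \<Rightarrow> ('m, 'v::real_vector) vbundle \<Rightarrow>
   ('m \<Rightarrow> 'v \<Rightarrow> 'm tvec) \<Rightarrow> (('m \<Rightarrow> 'v) \<Rightarrow> ('m \<Rightarrow> 'v) \<Rightarrow> 'm \<Rightarrow> 'v) \<Rightarrow> bool" where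
  "almost_lie_algebroid At A \<rho> br \<longleftrightarrow>
     vector_bundle At A \<and> anchor_map At A \<rho> \<and>
     (\<forall>s\<in>sections At A. \<forall>t\<in>sections At A.
        br s t \<in> sections At A \<and>
        (\<forall>u\<in>sections At A. \<forall>a b.
           br s (\<lambda>p. a *\<^sub>R t p + b *\<^sub>R u p) = (\<lambda>p. a *\<^sub>R br s t p + b *\<^sub>R br s u p) \<and>
           br (\<lambda>p. a *\<^sub>R t p + b *\<^sub>R u p) s = (\<lambda>p. a *\<^sub>R br t s p + b *\<^sub>R br u s p)) \<and>
        br s t = (\<lambda>p. - br t s p) \<and>
        anchor_on \<rho> (br s t) = lie_bracket (anchor_on \<rho> s) (anchor_on \<rho> t) \<and>
        (\<forall>f\<in>C_inf At.
           br s (\<lambda>p. f p *\<^sub>R t p) = (\<lambda>p. anchor_on \<rho> s p f *\<^sub>R t p + f p *\<^sub>R br s t p)))"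

section \<open>Connections\<close>

(* A section of the bundle tensor product of T*M with A is a smooth family of linear maps from the
   tangent spaces to the fibres of A; nab s p v stands for the value of \<nabla>s at v in T_p M. *)
definition connection ::
  "('m::topological_space, 'e::real_normed_vector) chart set \<Rightarrow> ('m, 'v::real_vector) vbundle \<Rightarrow>
   (('m \<Rightarrow> 'v) \<Rightarrow> 'm \<Rightarrow> 'm tvec \<Rightarrow> 'v) \<Rightarrow> bool" where
  "connection At A nab \<longleftrightarrow>
     (\<forall>s\<in>sections At A.
        (\<forall>p. tangent_linear At p (nab s p) \<and> (\<forall>v\<in>tangent_space At p. nab s p v \<in> fibre A p)) \<and>
        (\<forall>X\<in>vfields At UNIV. (\<lambda>p. nab s p (X p)) \<in> sections At A) \<and>
        (\<forall>t\<in>sections At A. \<forall>p. \<forall>v\<in>tangent_space At p.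
           nab (\<lambda>q. s q + t q) p v = nab s p v + nab t p v) \<and>
        (\<forall>f\<in>C_inf At. \<forall>p. \<forall>v\<in>tangent_space At p.
           nab (\<lambda>q. f q *\<^sub>R s q) p v = v f *\<^sub>R s p + f p *\<^sub>R nab s p v))"

(* The induced A-connection on TM. *)
definition A_connection ::
  "('m \<Rightarrow> 'v \<Rightarrow> 'm tvec) \<Rightarrow> (('m \<Rightarrow> 'v) \<Rightarrow> 'm \<Rightarrow> 'm tvec \<Rightarrow> 'v) \<Rightarrow> ('m \<Rightarrow> 'v) \<Rightarrow> 'm vfield \<Rightarrow> 'm vfield" where
  "A_connection \<rho> nab s X =
     (\<lambda>p f. lie_bracket (anchor_on \<rho> s) X p f + \<rho> p (nab s p (X p)) f)"

(* Its extension to covariant 2-tensors, as forced by the Leibniz rule, compatibility with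
   contractions, and the action through the anchor on functions. *)
definition A_connection_metric ::
  "('m \<Rightarrow> 'v \<Rightarrow> 'm tvec) \<Rightarrow> (('m \<Rightarrow> 'v) \<Rightarrow> 'm \<Rightarrow> 'm tvec \<Rightarrow> 'v) \<Rightarrow> ('m \<Rightarrow> 'v) \<Rightarrow> 'm metric \<Rightarrow> 'm cov2" where
  "A_connection_metric \<rho> nab s g = (\<lambda>Y Z p.
     anchor_on \<rho> s p (\<lambda>q. g q (Y q) (Z q))
     - g p (A_connection \<rho> nab s Y p) (Z p) - g p (Y p) (A_connection \<rho> nab s Z p))"

definition metric_parallel ::
  "('m::topological_space, 'e::real_normed_vector) chart set \<Rightarrow> ('m, 'v::real_vector) vbundle \<Rightarrow>
   ('m \<Rightarrow> 'v \<Rightarrow> 'm tvec) \<Rightarrow> (('m \<Rightarrow> 'v) \<Rightarrow> 'm \<Rightarrow> 'm tvec \<Rightarrow> 'v) \<Rightarrow> 'm metric \<Rightarrow> bool" where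
  "metric_parallel At A \<rho> nab g \<longleftrightarrow>
     (\<forall>s\<in>sections At A. \<forall>Y\<in>vfields At UNIV. \<forall>Z\<in>vfields At UNIV. \<forall>p.
        A_connection_metric \<rho> nab s g Y Z p = 0)"

end

theory Submission
  imports Defs
begin

text \<open>If \<open>L\<^bsub>\<rho>(s)\<^esub> g\<close> is a sum of products \<open>\<omega>\<^sub>j \<odot> g\<^sub>\<flat>(\<rho>(t\<^sub>j))\<close>, then any connection with
  \<open>\<nabla>s = \<Sum>\<^sub>j \<omega>\<^sub>j \<otimes> t\<^sub>j\<close> annihilates \<open>g\<close> in the direction of \<open>s\<close>. Because
  \<open>L\<^bsub>fX\<^esub> g = f L\<^bsub>X\<^esub> g + df \<odot> g\<^sub>\<flat>(X)\<close>, this property passes from \<open>s\<close> to \<open>f s\<close> by the Leibniz rule, so it is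
  enough to prescribe \<open>\<nabla>\<close> in this way on a local frame, cut off to compactly supported sections. The
  resulting local connections are glued with a partition of unity, which gives (ii). For (i), take
  the trivial bundle with \<open>\<rho>(e\<^sub>a) = X\<^sub>a\<close>; involutivity, applied to cut-off generators, yields local structure
  functions of \<open>[X\<^sub>a, X\<^sub>b]\<close>, which are glued and antisymmetrised to define the bracket, and (ii)
  supplies the connection.\<close>

section \<open>Calculus of functions of class \<open>C\<^sup>k\<close>\<close>

text \<open>Two obstacles shape the proof. Elements of the foliation have compact support, whereas
  sections of the bundle and the generators \<open>X a\<close> need not. The condition on the Lie
  derivative and involutivity are therefore available only after cutting off, and what they yield is
  correct only where the cut-off equals 1; a second bump function, supported in that region, turns
  the outcome into an identity valid everywhere. Moreover, tangent vectors are derivations of the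
  algebra of global smooth functions, so coefficients must be defined globally before they can be
  differentiated, and local equalities have to pass through \<open>tangent_local\<close>.

  In (i) the generators may satisfy linear relations, so their structure functions are a choice.
  Smoothness and skew-symmetry of the choice can be arranged, but only the image of the bracket
  under the anchor is controlled; the Jacobi identity does not follow. This is why the construction
  ends in an almost Lie algebroid.\<close>

lemma Ck_on_subset: "Ck_on k S f \<Longrightarrow> T \<subseteq> S \<Longrightarrow> Ck_on k T f"
proof (induction k arbitrary: f)
  case 0
  then show ?case by (auto intro: continuous_on_subset)
next
  case (Suc k)
  then show ?case by (simp only: Ck_on.simps) blast
qed

lemma Ck_on_SucD: "Ck_on (Suc k) S f \<Longrightarrow> Ck_on k S f"
proof (induction k arbitrary: f)
  case 0
  then show ?case
    by (auto intro!: continuous_at_imp_continuous_on dest: has_derivative_continuous)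
next
  case (Suc k)
  then obtain f' where f': "\<forall>x\<in>S. (f has_derivative f' x) (at x)" "\<And>v. Ck_on (Suc k) S (\<lambda>x. f' x v)"
    by (subst (asm) Ck_on.simps) blast
  then have "\<And>v. Ck_on k S (\<lambda>x. f' x v)"
    using Suc.IH by blast
  with f' show ?case by (simp only: Ck_on.simps) blast
qed

lemma Ck_on_cong:
  assumes "open S" "\<And>x. x \<in> S \<Longrightarrow> f x = g x" "Ck_on k S f"
  shows "Ck_on k S g"
proof (cases k)
  case 0
  then show ?thesis using assms continuous_on_cong[of S S f g] by simp
next
  case (Suc m)
  then obtain f' where "\<forall>x\<in>S. (f has_derivative f' x) (at x)" "\<forall>v. Ck_on m S (\<lambda>x. f' x v)"
    using assms by auto
  then show ?thesis
    unfolding Suc Ck_on.simps using has_derivative_transform_within_open[OF _ assms(1)] assms(2)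
    by blast
qed

text \<open>\<open>Ck_on\<close> only asserts that some derivative field exists. Uniqueness of
  derivatives makes \<open>frechet_derivative\<close> a canonical witness, so fields found on
  different neighbourhoods agree and can be patched in \<open>Ck_on_locally\<close>.\<close>

lemma Ck_on_Suc_iff:
  assumes "open S"
  shows "Ck_on (Suc k) S f \<longleftrightarrow>
    (\<forall>x\<in>S. f differentiable at x) \<and> (\<forall>v. Ck_on k S (\<lambda>x. frechet_derivative f (at x) v))"
    (is "_ \<longleftrightarrow> ?R")
proof
  assume "Ck_on (Suc k) S f"
  then obtain f' where f': "\<forall>x\<in>S. (f has_derivative f' x) (at x)" "\<And>v. Ck_on k S (\<lambda>x. f' x v)"
    by auto
  then have "x \<in> S \<Longrightarrow> f' x v = frechet_derivative f (at x) v" for x v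
    using frechet_derivative_at by metis
  with f' show ?R
    using Ck_on_cong[OF assms, of "\<lambda>x. f' x _" "\<lambda>x. frechet_derivative f (at x) _" k]
    by (auto simp: differentiable_def)
next
  assume ?R
  then show "Ck_on (Suc k) S f"
    unfolding Ck_on.simps
    by (intro exI[of _ "\<lambda>x. frechet_derivative f (at x)"]) (auto simp: frechet_derivative_works)
qed

lemma Ck_on_locally:
  assumes "open S" "\<And>x. x \<in> S \<Longrightarrow> \<exists>T. open T \<and> x \<in> T \<and> Ck_on k (S \<inter> T) f"
  shows "Ck_on k S f"
  using assms(2)
proof (induction k arbitrary: f)
  case 0
  show ?case
  proof (simp, rule continuous_at_imp_continuous_on, rule)
    fix x assume "x \<in> S"
    then obtain T where "open T" "x \<in> T" "continuous_on (S \<inter> T) f"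
      using 0[of x] by auto
    then show "isCont f x"
      using assms(1) \<open>x \<in> S\<close> continuous_on_eq_continuous_at[of "S \<inter> T" f] by (simp add: open_Int)
  qed
next
  case (Suc k)
  have *: "\<exists>T. open T \<and> x \<in> T \<and> f differentiable at x \<and>
      (\<forall>v. Ck_on k (S \<inter> T) (\<lambda>x. frechet_derivative f (at x) v))" if x: "x \<in> S" for x
  proof -
    obtain T where "open T" "x \<in> T" "Ck_on (Suc k) (S \<inter> T) f"
      using Suc.prems[OF x] by blast
    moreover from this have "f differentiable at x"
        "\<forall>v. Ck_on k (S \<inter> T) (\<lambda>x. frechet_derivative f (at x) v)"
      using Ck_on_Suc_iff[of "S \<inter> T" k f] assms(1) x by (simp_all add: open_Int del: Ck_on.simps)
    ultimately show ?thesis by (intro exI[of _ T] conjI)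
  qed
  have "Ck_on k S (\<lambda>x. frechet_derivative f (at x) v)" for v
  proof (rule Suc.IH)
    show "\<exists>T. open T \<and> x \<in> T \<and> Ck_on k (S \<inter> T) (\<lambda>x. frechet_derivative f (at x) v)"
      if "x \<in> S" for x
      using *[OF that] by blast
  qed
  with * show ?case unfolding Ck_on_Suc_iff[OF assms(1)] by blast
qed

lemma Ck_on_const: "Ck_on k S (\<lambda>x. c)"
proof (induction k arbitrary: c)
  case (Suc k)
  then show ?case
    unfolding Ck_on.simps by (intro exI[of _ "\<lambda>x v. 0"] conjI ballI allI has_derivative_const)
qed simp

lemma Ck_on_add: "Ck_on k S f \<Longrightarrow> Ck_on k S g \<Longrightarrow> Ck_on k S (\<lambda>x. f x + g x)"
proof (induction k arbitrary: f g)
  case 0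
  then show ?case by (auto intro: continuous_intros)
next
  case (Suc k)
  from Suc.prems obtain f' g' where
      "\<forall>x\<in>S. (f has_derivative f' x) (at x)" "\<And>v. Ck_on k S (\<lambda>x. f' x v)"
      "\<forall>x\<in>S. (g has_derivative g' x) (at x)" "\<And>v. Ck_on k S (\<lambda>x. g' x v)"
    by auto
  then show ?case
    unfolding Ck_on.simps
    by (intro exI[of _ "\<lambda>x v. f' x v + g' x v"] conjI ballI allI has_derivative_add Suc.IH) auto
qed

text \<open>Done once for all bilinear products, since multiplication, inner product and scalar
  multiplication all occur. The product rule leaves one factor undifferentiated, which is where
  \<open>Ck_on_SucD\<close> comes in.\<close>

lemma (in bounded_bilinear) Ck_on:
  "Ck_on k S f \<Longrightarrow> Ck_on k S g \<Longrightarrow> Ck_on k S (\<lambda>x. prod (f x) (g x))"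
proof (induction k arbitrary: f g)
  case 0
  then show ?case by (auto intro: continuous_on)
next
  case (Suc k)
  from Suc.prems obtain f' g' where
      "\<forall>x\<in>S. (f has_derivative f' x) (at x)" "\<And>v. Ck_on k S (\<lambda>x. f' x v)"
      "\<forall>x\<in>S. (g has_derivative g' x) (at x)" "\<And>v. Ck_on k S (\<lambda>x. g' x v)"
    by auto
  moreover have "Ck_on k S f" "Ck_on k S g"
    by (fact Suc.prems[THEN Ck_on_SucD])+
  ultimately show ?case
    unfolding Ck_on.simps
    by (intro exI[of _ "\<lambda>x v. prod (f x) (g' x v) + prod (f' x v) (g x)"]
        conjI ballI allI FDERIV Ck_on_add Suc.IH) auto
qed

lemmas Ck_on_mult = bounded_bilinear.Ck_on[OF bounded_bilinear_mult]
lemmas Ck_on_inner = bounded_bilinear.Ck_on[OF bounded_bilinear_inner]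

lemma Ck_on_inverse:
  fixes f :: "'a::real_normed_vector \<Rightarrow> real"
  assumes "\<And>x. x \<in> S \<Longrightarrow> f x \<noteq> 0"
  shows "Ck_on k S f \<Longrightarrow> Ck_on k S (\<lambda>x. inverse (f x))"
proof (induction k)
  case 0
  then show ?case using assms by (auto intro: continuous_intros)
next
  case (Suc k)
  from Suc.prems obtain f' where
      f': "\<forall>x\<in>S. (f has_derivative f' x) (at x)" "\<And>v. Ck_on k S (\<lambda>x. f' x v)"
    by auto
  have "Ck_on k S (\<lambda>x. inverse (f x))"
    by (rule Suc.IH[OF Ck_on_SucD[OF Suc.prems]])
  then have "Ck_on k S (\<lambda>x. (- 1) * (inverse (f x) * f' x v * inverse (f x)))" for v
    by (intro Ck_on_mult Ck_on_const f'(2))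
  moreover have "((\<lambda>x. inverse (f x)) has_derivative
      (\<lambda>v. (- 1) * (inverse (f x) * f' x v * inverse (f x)))) (at x)" if "x \<in> S" for x
    using Deriv.has_derivative_inverse[of f x, OF assms[OF that]] f' that by simp
  ultimately show ?case
    unfolding Ck_on.simps
    by (intro exI[of _ "\<lambda>x v. (- 1) * (inverse (f x) * f' x v * inverse (f x))"] conjI ballI allI)
qed

text \<open>\<open>Ck_on\<close> differentiates along constant directions, while the chain rule asks
  for the derivative of \<beta> in the direction \<open>u' x v\<close>, which moves with
  \<open>x\<close>. For real-valued \<open>u\<close> linearity pulls this direction out as a scalar
  in front of \<open>\<beta>' (u x) 1\<close>, and the induction hypothesis applies.\<close>

lemma Ck_on_compose_real:
  fixes u :: "'a::real_normed_vector \<Rightarrow> real" and \<beta> :: "real \<Rightarrow> 'b::real_normed_algebra"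
  assumes "u ` S \<subseteq> T"
  shows "Ck_on k T \<beta> \<Longrightarrow> Ck_on k S u \<Longrightarrow> Ck_on k S (\<lambda>x. \<beta> (u x))"
proof (induction k arbitrary: \<beta>)
  case 0
  then show ?case using continuous_on_compose2[of T \<beta> S u] assms by simp
next
  case (Suc k)
  from Suc.prems obtain \<beta>' u' where d:
      "\<forall>x\<in>T. (\<beta> has_derivative \<beta>' x) (at x)" "\<And>v. Ck_on k T (\<lambda>x. \<beta>' x v)"
      "\<forall>x\<in>S. (u has_derivative u' x) (at x)" "\<And>v. Ck_on k S (\<lambda>x. u' x v)"
    by auto
  have "((\<lambda>x. \<beta> (u x)) has_derivative (\<lambda>v. u' x v *\<^sub>R \<beta>' (u x) 1)) (at x)" if "x \<in> S" for x
  proof -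
    have b: "(\<beta> has_derivative \<beta>' (u x)) (at (u x))"
      using d(1) assms that by blast
    have "\<beta>' (u x) t = t *\<^sub>R \<beta>' (u x) 1" for t
      using linear_scale[OF has_derivative_linear[OF b], of t 1] by simp
    then have "(\<lambda>v. \<beta>' (u x) (u' x v)) = (\<lambda>v. u' x v *\<^sub>R \<beta>' (u x) 1)"
      by (intro ext)
    then show ?thesis
      using has_derivative_compose[OF d(3)[rule_format, OF that] b] by (simp only:)
  qed
  moreover have "Ck_on k S (\<lambda>x. u' x v *\<^sub>R \<beta>' (u x) 1)" for v
    by (rule bounded_bilinear.Ck_on[OF bounded_bilinear_scaleR d(4)
          Suc.IH[OF d(2) Ck_on_SucD[OF Suc.prems(2)]]])
  ultimately show ?case
    unfolding Ck_on.simps by (intro exI[of _ "\<lambda>x v. u' x v *\<^sub>R \<beta>' (u x) 1"] conjI ballI allI)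
qed

section \<open>A smooth cut-off function on the real line\<close>

text \<open>The division by \<open>x ^ n\<close> makes the span of the family closed under
  differentiation, so one induction with \<open>n\<close> arbitrary proves smoothness. The cut-off
  itself uses only \<open>n = 0\<close>.\<close>

definition flat_exp :: "nat \<Rightarrow> real \<Rightarrow> real" where
  "flat_exp n x = (if x > 0 then exp (- 1 / x) / x ^ n else 0)"

lemma flat_exp_has_derivative:
  "(flat_exp n has_real_derivative flat_exp (n + 2) x - real n * flat_exp (n + 1) x) (at x)"
proof -
  consider "x > 0" | "x < 0" | "x = 0" by linarith
  then show ?thesis
  proof cases
    case 1
    have "((\<lambda>x. exp (- 1 / x) / x ^ n) has_real_derivative
        flat_exp (n + 2) x - real n * flat_exp (n + 1) x) (at x)"
    proof -
      have "((\<lambda>x. exp (- 1 / x) / x ^ n) has_real_derivative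
          (exp (- 1 / x) * (1 / (x * x)) * x ^ n - exp (- 1 / x) * (real n * x ^ (n - 1))) / (x ^ n * x ^ n)) (at x)"
        using 1 by (auto intro!: derivative_eq_intros)
      \<comment> \<open>The truncated exponent at \<open>n = 0\<close> is harmless because of the
        factor \<open>real n\<close>.\<close>
      moreover have "real n * x ^ (n - 1) = real n * x ^ n / x"
        using 1 by (cases n) auto
      ultimately show ?thesis
        using 1 by (simp add: flat_exp_def diff_divide_distrib mult.commute)
    qed
    then show ?thesis
      by (rule has_field_derivative_transform_within_open[of _ _ _ "{0<..}"])
         (use 1 in \<open>auto simp: flat_exp_def\<close>)
  next
    case 2
    have "((\<lambda>x. 0) has_real_derivative 0) (at x)"
      by simp
    then have "(flat_exp n has_real_derivative 0) (at x)"
      by (rule has_field_derivative_transform_within_open[of _ _ _ "{..<0}"])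
         (use 2 in \<open>auto simp: flat_exp_def\<close>)
    then show ?thesis using 2 by (simp add: flat_exp_def)
  next
    case 3
    \<comment> \<open>With y = 1/h the difference quotient from the right is y^(n+1) / exp y, and
      exponentials beat powers.\<close>
    have "((\<lambda>h::real. inverse h ^ Suc n / exp (inverse h)) \<longlongrightarrow> 0) (at_right 0)"
      by (rule filterlim_compose[OF tendsto_power_div_exp_0 filterlim_inverse_at_top_right])
    then have "((\<lambda>h. flat_exp n h / h) \<longlongrightarrow> 0) (at_right 0)"
      by (rule Lim_transform_eventually)
         (auto simp: flat_exp_def eventually_at_filter exp_minus field_simps)
    moreover have "((\<lambda>h. flat_exp n h / h) \<longlongrightarrow> 0) (at_left 0)"
      by (rule Lim_transform_eventually[of "\<lambda>_. 0"]) (auto simp: flat_exp_def eventually_at_filter)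
    ultimately have "((\<lambda>h. flat_exp n h / h) \<longlongrightarrow> 0) (at 0)"
      by (simp add: filterlim_split_at)
    then show ?thesis
      using 3 by (simp add: DERIV_def flat_exp_def)
  qed
qed

lemma Ck_on_flat_exp: "Ck_on k UNIV (flat_exp n)"
proof (induction k arbitrary: n)
  case 0
  then show ?case
    by (simp add: continuous_at_imp_continuous_on DERIV_isCont[OF flat_exp_has_derivative])
next
  case (Suc k)
  have "(flat_exp n has_derivative
      (\<lambda>v. (flat_exp (n + 2) x + (- real n) * flat_exp (n + 1) x) * v)) (at x)" for x
    using flat_exp_has_derivative[of n x] by (simp add: has_field_derivative_def)
  moreover have "Ck_on k UNIV
      (\<lambda>x. (flat_exp (n + 2) x + (- real n) * flat_exp (n + 1) x) * v)" for v
    by (intro Ck_on_add Ck_on_mult Ck_on_const Suc)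
  ultimately show ?case
    unfolding Ck_on.simps
    by (intro exI[of _ "\<lambda>x v. (flat_exp (n + 2) x + (- real n) * flat_exp (n + 1) x) * v"]) blast
qed

definition plateau :: "real \<Rightarrow> real" where
  "plateau t = flat_exp 0 (2 - t) * inverse (flat_exp 0 (2 - t) + flat_exp 0 (t - 1))"

lemma flat_exp_nonneg: "flat_exp 0 x \<ge> 0" and flat_exp_pos: "x > 0 \<Longrightarrow> flat_exp 0 x > 0"
  by (auto simp: flat_exp_def)

lemma plateau_eq_1: "t \<le> 1 \<Longrightarrow> plateau t = 1"
  by (simp add: plateau_def flat_exp_def)

lemma plateau_eq_0: "t \<ge> 2 \<Longrightarrow> plateau t = 0"
  by (simp add: plateau_def flat_exp_def)

lemma Ck_on_id: "Ck_on k S (\<lambda>x. x)"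
proof (cases k)
  case (Suc m)
  then show ?thesis
    using Ck_on_const by (auto intro!: exI[of _ "\<lambda>x v. v"])
qed simp

lemma Ck_on_plateau: "Ck_on k UNIV plateau"
proof -
  have "Ck_on k UNIV (\<lambda>t. flat_exp 0 (2 + (- 1) * t))" "Ck_on k UNIV (\<lambda>t. flat_exp 0 (t + (- 1)))"
    by (intro Ck_on_compose_real[OF _ Ck_on_flat_exp] Ck_on_add Ck_on_mult Ck_on_const Ck_on_id subset_UNIV)+
  then have 1: "Ck_on k UNIV (\<lambda>t. flat_exp 0 (2 - t))" "Ck_on k UNIV (\<lambda>t. flat_exp 0 (t - 1))"
    by simp_all
  \<comment> \<open>The half-lines t < 2 and t > 1 cover the reals, so one of the two nonnegative
    summands is positive.\<close>
  have "flat_exp 0 (2 - t) + flat_exp 0 (t - 1) \<noteq> 0" for t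
    using flat_exp_nonneg[of "2 - t"] flat_exp_nonneg[of "t - 1"] flat_exp_pos[of "2 - t"]
      flat_exp_pos[of "t - 1"] by (cases "t < 2") (auto simp: less_imp_neq add_nonneg_eq_0_iff)
  then show ?thesis
    unfolding plateau_def by (intro Ck_on_mult Ck_on_inverse Ck_on_add 1) blast
qed

section \<open>Smooth functions and partitions of unity\<close>

locale smooth_manifold =
  fixes At :: "('m::{t2_space,second_countable_topology}, 'e::{real_inner,heine_borel}) chart set"
  assumes atlas: "smooth_atlas At"
begin

lemma
  shows chart_union: "(\<Union>(U, \<phi>)\<in>At. U) = UNIV"
    and chart_homeo: "\<forall>(U, \<phi>)\<in>At.
      open U \<and> open (\<phi> ` U) \<and> homeomorphism U (\<phi> ` U) \<phi> (inv_into U \<phi>)"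
    and chart_trans: "\<forall>(U, \<phi>)\<in>At. \<forall>(V, \<psi>)\<in>At. smooth_on (\<phi> ` (U \<inter> V)) (\<psi> \<circ> inv_into U \<phi>)"
  using atlas unfolding smooth_atlas_def by - (elim conjE, assumption)+

lemma chart_cover: "\<exists>V \<phi>. (V, \<phi>) \<in> At \<and> p \<in> V"
proof -
  have "p \<in> (\<Union>(U, \<phi>)\<in>At. U)"
    by (simp only: chart_union UNIV_I)
  then show ?thesis by force
qed

lemma chart_homeomorphism:
  assumes "(V, \<phi>) \<in> At"
  shows "open V" "open (\<phi> ` V)" "homeomorphism V (\<phi> ` V) \<phi> (inv_into V \<phi>)"
  using bspec[OF chart_homeo assms] by simp_all

lemma chart_transition:
  assumes "(U, \<phi>) \<in> At" "(V, \<psi>) \<in> At"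
  shows "smooth_on (\<phi> ` (U \<inter> V)) (\<psi> \<circ> inv_into U \<phi>)"
  using bspec[OF bspec[OF chart_trans assms(1), simplified] assms(2)] by simp

lemma chart_inv:
  assumes "(V, \<phi>) \<in> At" "p \<in> V"
  shows "inv_into V \<phi> (\<phi> p) = p"
  by (rule homeomorphism_apply1[OF chart_homeomorphism(3)[OF assms(1)] assms(2)])

lemma open_chart_image:
  assumes "(V, \<phi>) \<in> At" "open U"
  shows "open (\<phi> ` (U \<inter> V))"
proof -
  have "\<phi> ` (U \<inter> V) = \<phi> ` V \<inter> inv_into V \<phi> -` U"
    by (auto simp: chart_inv[OF assms(1)])
  moreover have "continuous_on (\<phi> ` V) (inv_into V \<phi>)"
    by (rule homeomorphism_cont2[OF chart_homeomorphism(3)[OF assms(1)]])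
  ultimately show ?thesis
    using continuous_open_preimage[OF _ chart_homeomorphism(2)[OF assms(1)] assms(2)] by simp
qed

lemma smooth_funI:
  "(\<And>V \<phi> k. (V, \<phi>) \<in> At \<Longrightarrow> Ck_on k (\<phi> ` (U \<inter> V)) (\<lambda>x. f (inv_into V \<phi> x))) \<Longrightarrow> smooth_fun At U f"
  by (auto simp: smooth_fun_def smooth_on_def comp_def)

lemma smooth_funD:
  "smooth_fun At U f \<Longrightarrow> (V, \<phi>) \<in> At \<Longrightarrow> Ck_on k (\<phi> ` (U \<inter> V)) (\<lambda>x. f (inv_into V \<phi> x))"
  by (auto simp: smooth_fun_def smooth_on_def comp_def)

lemma smooth_fun_subset: "smooth_fun At U f \<Longrightarrow> W \<subseteq> U \<Longrightarrow> smooth_fun At W f"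
  by (rule smooth_funI) (rule Ck_on_subset[OF smooth_funD], auto)

lemma smooth_fun_cong:
  assumes "open U" "\<And>p. p \<in> U \<Longrightarrow> f p = h p" "smooth_fun At U f"
  shows "smooth_fun At U h"
proof (rule smooth_funI)
  fix V \<phi> k assume V: "(V, \<phi>) \<in> At"
  show "Ck_on k (\<phi> ` (U \<inter> V)) (\<lambda>x. h (inv_into V \<phi> x))"
    by (rule Ck_on_cong[OF open_chart_image[OF V assms(1)] _ smooth_funD[OF assms(3) V]])
       (use chart_inv[OF V] assms(2) in auto)
qed

lemma smooth_fun_locally:
  assumes "open U" "\<And>p. p \<in> U \<Longrightarrow> \<exists>W. open W \<and> p \<in> W \<and> smooth_fun At (U \<inter> W) f"
  shows "smooth_fun At U f"
proof (rule smooth_funI)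
  fix V \<phi> k assume V: "(V, \<phi>) \<in> At"
  show "Ck_on k (\<phi> ` (U \<inter> V)) (\<lambda>x. f (inv_into V \<phi> x))"
  proof (rule Ck_on_locally[OF open_chart_image[OF V assms(1)]])
    fix x assume "x \<in> \<phi> ` (U \<inter> V)"
    then obtain p where p: "x = \<phi> p" "p \<in> U" "p \<in> V" by blast
    obtain W where W: "open W" "p \<in> W" "smooth_fun At (U \<inter> W) f"
      using assms(2)[OF p(2)] by (elim exE conjE)
    \<comment> \<open>Injectivity of the chart on \<open>V\<close> is what makes images compatible
      with intersections.\<close>
    have "\<phi> ` (U \<inter> V) \<inter> \<phi> ` (W \<inter> V) \<subseteq> \<phi> ` (U \<inter> W \<inter> V)"
    proof
      fix y assume "y \<in> \<phi> ` (U \<inter> V) \<inter> \<phi> ` (W \<inter> V)"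
      then obtain a b where "y = \<phi> a" "a \<in> U" "a \<in> V" "y = \<phi> b" "b \<in> W" "b \<in> V" by blast
      moreover from this have "a = b" using chart_inv[OF V, of a] chart_inv[OF V, of b] by simp
      ultimately show "y \<in> \<phi> ` (U \<inter> W \<inter> V)" by blast
    qed
    then have "Ck_on k (\<phi> ` (U \<inter> V) \<inter> \<phi> ` (W \<inter> V)) (\<lambda>x. f (inv_into V \<phi> x))"
      by (rule Ck_on_subset[OF smooth_funD[OF W(3) V]])
    moreover have "x \<in> \<phi> ` (W \<inter> V)"
      using p W(2) by blast
    ultimately show "\<exists>T. open T \<and> x \<in> T \<and> Ck_on k (\<phi> ` (U \<inter> V) \<inter> T) (\<lambda>x. f (inv_into V \<phi> x))"
      using open_chart_image[OF V W(1)] by (intro exI[of _ "\<phi> ` (W \<inter> V)"] conjI)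
  qed
qed

lemma smooth_fun_const [simp]: "smooth_fun At U (\<lambda>p. c)"
  by (intro smooth_funI Ck_on_const)

lemma smooth_fun_add:
  "smooth_fun At U f \<Longrightarrow> smooth_fun At U h \<Longrightarrow> smooth_fun At U (\<lambda>p. f p + h p)"
  by (intro smooth_funI Ck_on_add) (erule (1) smooth_funD)+

lemma smooth_fun_mult:
  "smooth_fun At U f \<Longrightarrow> smooth_fun At U h \<Longrightarrow> smooth_fun At U (\<lambda>p. f p * h p)"
  by (intro smooth_funI Ck_on_mult) (erule (1) smooth_funD)+

lemma smooth_fun_diff:
  assumes "smooth_fun At U f" "smooth_fun At U h"
  shows "smooth_fun At U (\<lambda>p. f p - h p)"
  using smooth_fun_add[OF assms(1) smooth_fun_mult[OF smooth_fun_const[of U "- 1"] assms(2)]] by simp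

lemma smooth_fun_sum:
  assumes "\<And>i. i \<in> I \<Longrightarrow> smooth_fun At U (f i)"
  shows "smooth_fun At U (\<lambda>p. \<Sum>i\<in>I. f i p)"
  using assms
proof (induction I rule: infinite_finite_induct)
  case (insert i I)
  then have "smooth_fun At U (\<lambda>p. f i p + (\<Sum>i\<in>I. f i p))"
    by (intro smooth_fun_add) simp_all
  with insert.hyps show ?case by simp
qed simp_all

lemma smooth_fun_prod:
  assumes "\<And>i. i \<in> I \<Longrightarrow> smooth_fun At U (f i)"
  shows "smooth_fun At U (\<lambda>p. \<Prod>i\<in>I. f i p)"
  using assms
proof (induction I rule: infinite_finite_induct)
  case (insert i I)
  then have "smooth_fun At U (\<lambda>p. f i p * (\<Prod>i\<in>I. f i p))"
    by (intro smooth_fun_mult) simp_all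
  with insert.hyps show ?case by simp
qed simp_all

text \<open>The length \<open>N\<close> need not be locally constant, only locally bounded: near
  each point it can be replaced by a constant bound, because the added terms vanish.\<close>

lemma smooth_fun_locally_finite_sum:
  assumes "open U" "\<And>i. smooth_fun At U (f i)" "\<And>i p. p \<in> U \<Longrightarrow> i \<ge> N p \<Longrightarrow> f i p = 0"
    and "\<And>p. \<exists>W (n::nat). open W \<and> p \<in> W \<and> (\<forall>q\<in>W. N q \<le> n)"
  shows "smooth_fun At U (\<lambda>p. \<Sum>i<N p. f i p)"
proof (rule smooth_fun_locally[OF assms(1)])
  fix p assume "p \<in> U"
  obtain W n where W: "open W" "p \<in> W" "\<And>q. q \<in> W \<Longrightarrow> N q \<le> n"
    using assms(4)[of p] by (elim exE conjE) blast
  have "smooth_fun At (U \<inter> W) (\<lambda>p. \<Sum>i<N p. f i p)"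
  proof (rule smooth_fun_cong)
    show "open (U \<inter> W)"
      using assms(1) W(1) by (rule open_Int)
    show "smooth_fun At (U \<inter> W) (\<lambda>q. \<Sum>i<n. f i q)"
      by (rule smooth_fun_sum, rule smooth_fun_subset[OF assms(2)], rule Int_lower1)
    show "(\<Sum>i<n. f i q) = (\<Sum>i<N q. f i q)" if "q \<in> U \<inter> W" for q
      using W(3)[of q] that by (intro sum.mono_neutral_right) (auto intro: assms(3))
  qed
  with W(1,2) show "\<exists>W. open W \<and> p \<in> W \<and> smooth_fun At (U \<inter> W) (\<lambda>p. \<Sum>i<N p. f i p)"
    by (intro exI[of _ W] conjI)
qed

text \<open>\<open>U\<close> and the complement of the closed support of \<open>c\<close> form an
  open cover; on the first set the function is a product of smooth functions, on the second it is
  zero. The values of \<open>f\<close> off \<open>U\<close> do not enter.\<close>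

lemma smooth_fun_extend_zero:
  assumes "open U" "c \<in> C_inf_c At U" "open V" "smooth_fun At (U \<inter> V) f"
  shows "smooth_fun At V (\<lambda>p. if p \<in> U then c p * f p else 0)" (is "smooth_fun At V ?f")
proof (rule smooth_fun_locally[OF assms(3)])
  fix p assume "p \<in> V"
  define K where "K = closure {p. c p \<noteq> 0}"
  have K: "K \<subseteq> U" "open (- K)" and c: "smooth_fun At UNIV c"
    using assms(2) by (simp_all add: C_inf_c_def C_inf_def K_def open_Compl)
  have UV: "open (V \<inter> U)" "open (V \<inter> - K)"
    using assms(1,3) K(2) by (simp_all add: open_Int)
  show "\<exists>W. open W \<and> p \<in> W \<and> smooth_fun At (V \<inter> W) ?f"
  proof (cases "p \<in> U")
    case True
    have "smooth_fun At (V \<inter> U) (\<lambda>p. c p * f p)"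
      by (rule smooth_fun_mult[OF smooth_fun_subset[OF c] smooth_fun_subset[OF assms(4)]]) simp_all
    then have "smooth_fun At (V \<inter> U) ?f"
      by (rule smooth_fun_cong[OF UV(1), rotated]) simp
    with True assms(1) show ?thesis by (intro exI[of _ U] conjI)
  next
    case False
    have "c q = 0" if "q \<notin> K" for q
      using that closure_subset[of "{p. c p \<noteq> 0}"] unfolding K_def by blast
    then have "smooth_fun At (V \<inter> - K) ?f"
      by (intro smooth_fun_cong[OF UV(2) _ smooth_fun_const[of _ 0]]) simp
    moreover have "p \<in> - K" using False K by blast
    ultimately show ?thesis using K(2) by (intro exI[of _ "- K"] conjI)
  qed
qed

section \<open>Bump functions and partitions of unity\<close>

lemma bump:
  assumes "open O'" "p \<in> O'"
  obtains b W where "b \<in> C_inf_c At O'" "open W" "p \<in> W" "W \<subseteq> O'" "\<And>q. q \<in> W \<Longrightarrow> b q = 1"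
proof -
  obtain V \<phi> where V: "(V, \<phi>) \<in> At" "p \<in> V"
    using chart_cover by blast
  have "open (\<phi> ` (O' \<inter> V))" "\<phi> p \<in> \<phi> ` (O' \<inter> V)"
    using open_chart_image[OF V(1) assms(1)] V assms by auto
  then obtain e where e: "e > 0" "cball (\<phi> p) e \<subseteq> \<phi> ` (O' \<inter> V)"
    unfolding open_contains_cball by blast
  \<comment> \<open>The squared distance is used because it is smooth also at the centre. The factor
    \<open>2 / e\<^sup>2\<close> makes the argument of \<open>plateau\<close> at least 2 from radius
    \<open>e\<close> on and at most 1/2 within radius \<open>e / 2\<close>.\<close>
  define B where "B = (\<lambda>y. plateau (2 / e\<^sup>2 * ((y + - \<phi> p) \<bullet> (y + - \<phi> p))))"
  define b where "b = (\<lambda>q. if q \<in> V then B (\<phi> q) else 0)"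
  define K where "K = inv_into V \<phi> ` cball (\<phi> p) e"
  define W where "W = V \<inter> \<phi> -` ball (\<phi> p) (e / 2)"
  have B: "B y = plateau (2 * (dist (\<phi> p) y / e)\<^sup>2)" for y
    by (simp add: B_def dist_norm norm_minus_commute power_divide power2_norm_eq_inner)
  have cont: "continuous_on V \<phi>" "continuous_on (\<phi> ` V) (inv_into V \<phi>)"
    using chart_homeomorphism(3)[OF V(1)] by (auto simp: homeomorphism_def)
  have "cball (\<phi> p) e \<subseteq> \<phi> ` V"
    using e(2) by blast
  \<comment> \<open>Finite dimension of the model space enters here, through compactness of closed
    balls.\<close>
  then have "compact K"
    unfolding K_def using cont(2) by (meson compact_cball compact_continuous_image continuous_on_subset)
  have KO: "K \<subseteq> O' \<inter> V"
    using e(2) chart_inv[OF V(1)] unfolding K_def by force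
  have out: "b q = 0" if "q \<notin> K" for q
  proof (cases "q \<in> V")
    case True
    with that have "\<phi> q \<notin> cball (\<phi> p) e"
      using chart_inv[OF V(1) True] unfolding K_def by force
    then have "dist (\<phi> p) (\<phi> q) / e \<ge> 1"
      using e(1) by simp
    then show ?thesis
      by (simp add: b_def B plateau_eq_0)
  qed (simp add: b_def)
  \<comment> \<open>The Hausdorff property makes the compact set \<open>K\<close> closed in the
    whole manifold, not just in the chart domain; hence the extension by zero creates no boundary
    points of the support outside \<open>V\<close>.\<close>
  have "closure {q. b q \<noteq> 0} \<subseteq> K"
    using out \<open>compact K\<close> by (intro closure_minimal) (auto dest: compact_imp_closed)
  then have supp: "compact (closure {q. b q \<noteq> 0})" "closure {q. b q \<noteq> 0} \<subseteq> O'"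
    using \<open>compact K\<close> KO compact_Int_closed[of K "closure {q. b q \<noteq> 0}"] by (auto simp: Int_absorb1)
  have "smooth_fun At UNIV b"
  proof (rule smooth_fun_locally)
    fix q
    show "\<exists>W. open W \<and> q \<in> W \<and> smooth_fun At (UNIV \<inter> W) b"
    proof (cases "q \<in> V")
      case True
      have "smooth_fun At V b"
      proof (rule smooth_fun_cong)
        show "smooth_fun At V (\<lambda>q. B (\<phi> q))"
        proof (rule smooth_funI)
          fix V' \<psi> k assume V': "(V', \<psi>) \<in> At"
          have "Ck_on k (\<psi> ` (V \<inter> V')) (\<lambda>x. \<phi> (inv_into V' \<psi> x))"
            using chart_transition[OF V' V(1)] by (simp add: smooth_on_def comp_def Int_commute)
          then show "Ck_on k (\<psi> ` (V \<inter> V')) (\<lambda>x. B (\<phi> (inv_into V' \<psi> x)))"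
            unfolding B_def
            by (intro Ck_on_compose_real[OF subset_UNIV Ck_on_plateau] Ck_on_mult Ck_on_inner
                Ck_on_add Ck_on_const)
        qed
      qed (use chart_homeomorphism(1)[OF V(1)] in \<open>auto simp: b_def\<close>)
      with True chart_homeomorphism(1)[OF V(1)] show ?thesis
        by (intro exI[of _ V] conjI) simp_all
    next
      case False
      have "open (- K)" using \<open>compact K\<close> by (simp add: compact_imp_closed open_Compl)
      moreover from this have "smooth_fun At (- K) b"
        using out by (intro smooth_fun_cong[of "- K" "\<lambda>_. 0" b]) auto
      ultimately show ?thesis
        using False KO by (intro exI[of _ "- K"] conjI) auto
    qed
  qed simp
  moreover have "open W"
    unfolding W_def using continuous_open_preimage[OF cont(1) chart_homeomorphism(1)[OF V(1)]] by blast
  moreover have "p \<in> W" using V e by (simp add: W_def)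
  moreover have "b q = 1" if "q \<in> W" for q
  proof -
    define t where "t = dist (\<phi> p) (\<phi> q) / e"
    have "0 \<le> t" "t \<le> 1 / 2"
      using that e(1) by (simp_all add: W_def t_def field_simps)
    then have "t * t \<le> 1 / 2 * (1 / 2)"
      by (intro mult_mono) simp_all
    then have "plateau (2 * t\<^sup>2) = 1"
      by (intro plateau_eq_1) (simp add: power2_eq_square)
    then show ?thesis
      using that by (simp add: b_def B W_def t_def)
  qed
  moreover from this have "W \<subseteq> {q. b q \<noteq> 0}" by auto
  ultimately show thesis
    using that[of b W] supp closure_subset[of "{q. b q \<noteq> 0}"] by (auto simp: C_inf_c_def C_inf_def)
qed

text \<open>The partition of unity is \<open>\<psi> i * b (x i)\<close> with \<open>\<psi> i = (\<Prod>j<i. 1 - b (x j))\<close>: its partial sums telescope,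
  and on the plateau \<open>W (x n)\<close> all terms after the \<open>n\<close>-th vanish.\<close>

lemma partition_of_unity:
  fixes b :: "'m \<Rightarrow> 'm \<Rightarrow> real" and W :: "'m \<Rightarrow> 'm set"
  assumes "\<And>p. smooth_fun At UNIV (b p)" "\<And>p. open (W p)" "\<And>p. p \<in> W p"
    and "\<And>p q. q \<in> W p \<Longrightarrow> b p q = 1"
  obtains x :: "nat \<Rightarrow> 'm" and \<psi> :: "nat \<Rightarrow> 'm \<Rightarrow> real" and N :: "'m \<Rightarrow> nat"
  where "\<And>i. smooth_fun At UNIV (\<psi> i)" "\<And>p. (\<Sum>i<N p. \<psi> i p * b (x i) p) = 1"
    "\<And>i p. i \<ge> N p \<Longrightarrow> \<psi> i p = 0"
    "\<And>p. \<exists>U n. open U \<and> p \<in> U \<and> (\<forall>q\<in>U. N q \<le> n)"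
proof -
  \<comment> \<open>Second countability enters through Lindelof: countably many of the sets
    \<open>W p\<close> already cover the manifold.\<close>
  obtain F where F: "F \<subseteq> range W" "countable F" "\<Union>F = \<Union>(range W)"
    using Lindelof[of "range W"] assms(2) by auto
  then obtain X where X: "countable X" "F = W ` X"
    by (metis countable_subset_image)
  have cov: "(\<Union>p\<in>X. W p) = UNIV"
    using F(3) assms(3) X(2) by auto
  then have "X \<noteq> {}" by auto
  define x where "x = from_nat_into X"
  have "range x = X"
    using X(1) \<open>X \<noteq> {}\<close> by (simp add: x_def range_from_nat_into)
  then have ex: "\<exists>n. p \<in> W (x n)" for p
    using cov by (metis (no_types, opaque_lifting) UNIV_I UN_iff image_iff)
  define \<psi> where "\<psi> i p = (\<Prod>j<i. 1 - b (x j) p)" for i p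
  \<comment> \<open>\<open>Suc\<close> matters: the factor \<open>1 - b (x j) p\<close>, which is 0
    for \<open>p\<close> in \<open>W (x j)\<close>, occurs in \<open>\<psi> i p\<close> only when
    \<open>i > j\<close>.\<close>
  define N where "N p = Suc (LEAST n. p \<in> W (x n))" for p
  have tele: "(\<Sum>i<n. \<psi> i p * b (x i) p) = 1 - \<psi> n p" for n p
    by (induction n) (simp_all add: \<psi>_def algebra_simps)
  have van: "\<psi> i p = 0" if "i \<ge> N p" for i p
    using that LeastI_ex[OF ex[of p]] assms(4)[of p "x (LEAST n. p \<in> W (x n))"]
    by (auto simp: \<psi>_def N_def Suc_le_eq)
  show thesis
  proof (rule that)
    show "smooth_fun At UNIV (\<psi> i)" for i
      unfolding \<psi>_def[abs_def] by (intro smooth_fun_prod smooth_fun_diff smooth_fun_const assms)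
    show "(\<Sum>i<N p. \<psi> i p * b (x i) p) = 1" for p
      using tele van[OF order_refl] by simp
    show "\<exists>U n. open U \<and> p \<in> U \<and> (\<forall>q\<in>U. N q \<le> n)" for p
    proof -
      obtain n where "p \<in> W (x n)" using ex by blast
      then show ?thesis
        using assms(2) by (intro exI[of _ "W (x n)"] exI[of _ "Suc n"]) (auto simp: N_def intro: Least_le)
    qed
  qed (fact van)
qed

end

section \<open>Tangent vectors, vector fields and the metric\<close>

lemma C_inf_iff: "f \<in> C_inf At \<longleftrightarrow> smooth_fun At UNIV f"
  by (simp add: C_inf_def)

lemma C_inf_c_subset: "f \<in> C_inf_c At U \<Longrightarrow> smooth_fun At UNIV f"
  by (simp add: C_inf_c_def C_inf_def)

lemma C_inf_c_zero_outside: "f \<in> C_inf_c At U \<Longrightarrow> p \<notin> U \<Longrightarrow> f p = 0"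
  using closure_subset[of "{p. f p \<noteq> 0}"] by (auto simp: C_inf_c_def)

lemma tangent_nonsmooth:
  "v \<in> tangent_space At p \<Longrightarrow> \<not> smooth_fun At UNIV f \<Longrightarrow> v f = 0"
  by (simp add: tangent_space_def C_inf_iff)

lemma tangent_lin:
  "v \<in> tangent_space At p \<Longrightarrow> smooth_fun At UNIV f \<Longrightarrow> smooth_fun At UNIV h \<Longrightarrow>
    v (\<lambda>q. a * f q + b * h q) = a * v f + b * v h"
  by (simp add: tangent_space_def C_inf_iff)

lemma tangent_mult:
  "v \<in> tangent_space At p \<Longrightarrow> smooth_fun At UNIV f \<Longrightarrow> smooth_fun At UNIV h \<Longrightarrow>
    v (\<lambda>q. f q * h q) = v f * h p + f p * v h"
  by (simp add: tangent_space_def C_inf_iff)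

lemma tangent_add:
  "v \<in> tangent_space At p \<Longrightarrow> smooth_fun At UNIV f \<Longrightarrow> smooth_fun At UNIV h \<Longrightarrow>
    v (\<lambda>q. f q + h q) = v f + v h"
  using tangent_lin[of v At p f h 1 1] by simp

lemma tangent_diff:
  "v \<in> tangent_space At p \<Longrightarrow> smooth_fun At UNIV f \<Longrightarrow> smooth_fun At UNIV h \<Longrightarrow>
    v (\<lambda>q. f q - h q) = v f - v h"
  using tangent_lin[of v At p f h 1 "- 1"] by simp

lemma tangent_lincomb:
  assumes v: "v \<in> tangent_space At p" and w: "w \<in> tangent_space At p"
  shows "(\<lambda>f. a * v f + b * w f) \<in> tangent_space At p"
  unfolding tangent_space_def C_inf_iff mem_Collect_eq
  by (intro conjI allI impI ballI)
     (simp_all add: tangent_nonsmooth[OF v] tangent_nonsmooth[OF w] C_inf_iff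
       tangent_lin[OF v] tangent_lin[OF w] tangent_mult[OF v] tangent_mult[OF w] algebra_simps)

lemma tangent_zero: "(\<lambda>f. 0) \<in> tangent_space At p"
  by (simp add: tangent_space_def)

lemma tangent_sum:
  "(\<And>i. i < n \<Longrightarrow> v i \<in> tangent_space At p) \<Longrightarrow> (\<lambda>f. \<Sum>i<n::nat. c i * v i f) \<in> tangent_space At p"
proof (induction n)
  case 0
  then show ?case by (simp add: tangent_zero)
next
  case (Suc n)
  show ?case
    using tangent_lincomb[OF Suc.IH Suc.prems[of n], of 1 "c n"] Suc.prems by simp
qed

lemma tangent_linear_lincomb:
  "tangent_linear At p L \<Longrightarrow> v \<in> tangent_space At p \<Longrightarrow> w \<in> tangent_space At p \<Longrightarrow>
    L (\<lambda>f. a * v f + b * w f) = a *\<^sub>R L v + b *\<^sub>R L w"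
  by (simp add: tangent_linear_def)

lemma tangent_linear_zero: "tangent_linear At p L \<Longrightarrow> L (\<lambda>f. 0) = 0"
  using tangent_linear_lincomb[OF _ tangent_zero tangent_zero, of At p L 0 0] by simp

text \<open>Shaped after the right-hand side of \<open>lie_bracket_expansion\<close>, to which
  metric contractions will be applied. Linearity is assumed only on the tangent space, so the
  induction also has to place every partial sum there.\<close>

lemma tangent_linear_sum_diff:
  assumes L: "tangent_linear At p L"
  shows "(\<And>i. i < n \<Longrightarrow> v i \<in> tangent_space At p) \<Longrightarrow> (\<And>i. i < n \<Longrightarrow> w i \<in> tangent_space At p) \<Longrightarrow>
    L (\<lambda>f. \<Sum>i<n::nat. c i * v i f - d i * w i f) = (\<Sum>i<n. c i *\<^sub>R L (v i) - d i *\<^sub>R L (w i))"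
proof (induction n)
  case 0
  then show ?case by (simp add: tangent_linear_zero[OF L])
next
  case (Suc n)
  have 1: "(\<lambda>f. \<Sum>i<n. c i * v i f - d i * w i f) \<in> tangent_space At p"
    using tangent_lincomb[OF tangent_sum[of n v At p c] tangent_sum[of n w At p d], of 1 "- 1"]
      Suc.prems by (simp add: sum_subtractf)
  have 2: "(\<lambda>f. c n * v n f + (- d n) * w n f) \<in> tangent_space At p"
    using Suc.prems by (intro tangent_lincomb) simp_all
  have "L (\<lambda>f. \<Sum>i<Suc n. c i * v i f - d i * w i f)
      = L (\<lambda>f. \<Sum>i<n. c i * v i f - d i * w i f) + L (\<lambda>f. c n * v n f + (- d n) * w n f)"
    using tangent_linear_lincomb[OF L 1 2, of 1 1] by simp
  then show ?case
    using Suc.IH Suc.prems tangent_linear_lincomb[OF L Suc.prems, of n n "c n" "- d n"] by simp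
qed

lemma vfields_tangent: "X \<in> vfields At U \<Longrightarrow> p \<in> U \<Longrightarrow> X p \<in> tangent_space At p"
  by (simp add: vfields_def)

lemma vfields_tangent_UNIV: "X \<in> vfields At UNIV \<Longrightarrow> X p \<in> tangent_space At p"
  by (simp add: vfields_def)

lemma vfields_smooth: "X \<in> vfields At U \<Longrightarrow> smooth_fun At UNIV f \<Longrightarrow> smooth_fun At U (\<lambda>p. X p f)"
  by (simp add: vfields_def C_inf_iff)

lemma vfieldsI:
  "(\<And>p. p \<in> U \<Longrightarrow> X p \<in> tangent_space At p) \<Longrightarrow>
    (\<And>f. smooth_fun At UNIV f \<Longrightarrow> smooth_fun At U (\<lambda>p. X p f)) \<Longrightarrow> X \<in> vfields At U"
  by (simp add: vfields_def C_inf_iff)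

context smooth_manifold
begin

lemma tangent_apply_zero: "v \<in> tangent_space At p \<Longrightarrow> v (\<lambda>q. 0) = 0"
  using tangent_lin[of v At p "\<lambda>q. 0" "\<lambda>q. 0" 0 0] by simp

lemma tangent_apply_sum:
  assumes v: "v \<in> tangent_space At p"
  shows "(\<And>i. i < n \<Longrightarrow> smooth_fun At UNIV (f i)) \<Longrightarrow> v (\<lambda>q. \<Sum>i<n::nat. f i q) = (\<Sum>i<n. v (f i))"
proof (induction n)
  case 0
  then show ?case by (simp add: tangent_apply_zero[OF v])
next
  case (Suc n)
  have "smooth_fun At UNIV (\<lambda>q. \<Sum>i<n. f i q)"
    by (rule smooth_fun_sum) (simp add: Suc.prems)
  then show ?case
    using tangent_add[OF v _ Suc.prems[of n], of "\<lambda>q. \<Sum>i<n. f i q"] Suc by simp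
qed

text \<open>For a bump \<open>b\<close> at \<open>p\<close> supported in \<open>U\<close>, the
  product \<open>b * (f - h)\<close> vanishes identically; the Leibniz rule then leaves
  \<open>v f - v h\<close>, as \<open>f - h\<close> is zero at \<open>p\<close> and \<open>b\<close>
  is one. Thus derivations of global functions see only germs.\<close>

lemma tangent_local:
  assumes v: "v \<in> tangent_space At p" and f: "smooth_fun At UNIV f" and h: "smooth_fun At UNIV h"
    and U: "open U" "p \<in> U" "\<And>q. q \<in> U \<Longrightarrow> f q = h q"
  shows "v f = v h"
proof -
  obtain b W where b: "b \<in> C_inf_c At U" "p \<in> W" "\<And>q. q \<in> W \<Longrightarrow> b q = 1"
    by (rule bump[OF U(1,2)]) blast
  have d: "smooth_fun At UNIV (\<lambda>q. f q - h q)"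
    by (rule smooth_fun_diff[OF f h])
  have "(\<lambda>q. b q * (f q - h q)) = (\<lambda>q. 0)"
  proof
    show "b q * (f q - h q) = 0" for q
      using U(3)[of q] C_inf_c_zero_outside[OF b(1), of q] by (cases "q \<in> U") simp_all
  qed
  then have "v b * (f p - h p) + b p * v (\<lambda>q. f q - h q) = 0"
    using tangent_mult[OF v C_inf_c_subset[OF b(1)] d] tangent_apply_zero[OF v] by simp
  then show ?thesis
    using U(2,3) b(2,3) tangent_diff[OF v f h] by simp
qed

lemma vfields_sum:
  assumes "\<And>i. i < n \<Longrightarrow> smooth_fun At U (c i)" "\<And>i. i < n \<Longrightarrow> X i \<in> vfields At U"
  shows "(\<lambda>p f. \<Sum>i<n::nat. c i p * X i p f) \<in> vfields At U"
proof (rule vfieldsI)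
  show "(\<lambda>f. \<Sum>i<n. c i p * X i p f) \<in> tangent_space At p" if "p \<in> U" for p
    by (rule tangent_sum) (rule vfields_tangent[OF assms(2) that])
  show "smooth_fun At U (\<lambda>p. \<Sum>i<n. c i p * X i p f)" if "smooth_fun At UNIV f" for f
    by (intro smooth_fun_sum smooth_fun_mult assms(1) vfields_smooth[OF assms(2) that]) simp_all
qed

text \<open>In the Leibniz rule the mixed terms \<open>X f * Y h\<close> cancel. On a non-smooth
  \<open>f\<close> both inner functions are constantly 0, so the normalisation of tangent vectors
  survives.\<close>

lemma lie_bracket_vfields:
  assumes X: "X \<in> vfields At UNIV" and Y: "Y \<in> vfields At UNIV"
  shows "lie_bracket X Y \<in> vfields At UNIV"
proof (rule vfieldsI)
  note Xt = vfields_tangent_UNIV[OF X] and Yt = vfields_tangent_UNIV[OF Y]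
  note Xs = vfields_smooth[OF X] and Ys = vfields_smooth[OF Y]
  show "smooth_fun At UNIV (\<lambda>p. lie_bracket X Y p f)" if f: "smooth_fun At UNIV f" for f
    unfolding lie_bracket_def by (intro smooth_fun_diff Xs Ys f)
  show "lie_bracket X Y p \<in> tangent_space At p" for p
    unfolding tangent_space_def C_inf_iff mem_Collect_eq
  proof (intro conjI allI impI ballI)
    fix f assume "\<not> smooth_fun At UNIV f"
    then show "lie_bracket X Y p f = 0"
      by (simp add: lie_bracket_def tangent_nonsmooth[OF Xt] tangent_nonsmooth[OF Yt]
          tangent_apply_zero[OF Xt] tangent_apply_zero[OF Yt])
  next
    fix f h a b assume "f \<in> C_inf At" "h \<in> C_inf At"
    then have f: "smooth_fun At UNIV f" and h: "smooth_fun At UNIV h"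
      by (simp_all add: C_inf_iff)
    show "lie_bracket X Y p (\<lambda>q. a * f q + b * h q) = a * lie_bracket X Y p f + b * lie_bracket X Y p h"
      by (simp add: lie_bracket_def tangent_lin[OF Xt] tangent_lin[OF Yt] Xs Ys f h algebra_simps)
    show "lie_bracket X Y p (\<lambda>q. f q * h q) = lie_bracket X Y p f * h p + f p * lie_bracket X Y p h"
      by (simp add: lie_bracket_def tangent_mult[OF Xt] tangent_mult[OF Yt]
          tangent_add[OF Xt] tangent_add[OF Yt] smooth_fun_mult Xs Ys f h algebra_simps)
  qed
qed

text \<open>Only near \<open>p\<close> is \<open>S\<close> a combination of the \<open>E a\<close>.
  This suffices because \<open>tangent_local\<close> allows \<open>Y p\<close> to differentiate the
  combination in place of \<open>S\<close>. For non-smooth \<open>h\<close> both sides are 0 by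
  normalisation.\<close>

lemma lie_bracket_expansion:
  assumes S: "S \<in> vfields At UNIV" and Y: "Y \<in> vfields At UNIV"
    and E: "\<And>a. a < k \<Longrightarrow> E a \<in> vfields At UNIV" and \<sigma>: "\<And>a. a < (k::nat) \<Longrightarrow> smooth_fun At UNIV (\<sigma> a)"
    and U: "open U" "p \<in> U" "\<And>q. q \<in> U \<Longrightarrow> S q = (\<lambda>h. \<Sum>a<k. \<sigma> a q * E a q h)"
  shows "lie_bracket S Y p = (\<lambda>h. \<Sum>a<k. \<sigma> a p * lie_bracket (E a) Y p h - Y p (\<sigma> a) * E a p h)"
proof
  fix h
  note Yt = vfields_tangent_UNIV[OF Y] and Et = vfields_tangent_UNIV[OF E]
  note Ss = vfields_smooth[OF S] and Ys = vfields_smooth[OF Y] and Es = vfields_smooth[OF E]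
  show "lie_bracket S Y p h = (\<Sum>a<k. \<sigma> a p * lie_bracket (E a) Y p h - Y p (\<sigma> a) * E a p h)"
  proof (cases "smooth_fun At UNIV h")
    case h: True
    have "Y p (\<lambda>q. S q h) = Y p (\<lambda>q. \<Sum>a<k. \<sigma> a q * E a q h)"
    proof (rule tangent_local[OF Yt Ss[OF h] _ U(1,2)])
      show "smooth_fun At UNIV (\<lambda>q. \<Sum>a<k. \<sigma> a q * E a q h)"
        by (intro smooth_fun_sum smooth_fun_mult \<sigma> Es h) simp_all
    qed (simp add: U(3))
    also have "\<dots> = (\<Sum>a<k. Y p (\<lambda>q. \<sigma> a q * E a q h))"
      by (rule tangent_apply_sum[OF Yt]) (intro smooth_fun_mult \<sigma> Es h)
    also have "\<dots> = (\<Sum>a<k. Y p (\<sigma> a) * E a p h + \<sigma> a p * Y p (\<lambda>q. E a q h))"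
      by (rule sum.cong[OF refl], rule tangent_mult[OF Yt]) (simp_all add: \<sigma> Es h)
    finally show ?thesis
      by (simp add: lie_bracket_def U(2,3) sum_subtractf sum.distrib right_diff_distrib)
  next
    case False
    then show ?thesis
      by (simp add: tangent_nonsmooth[OF vfields_tangent_UNIV[OF lie_bracket_vfields[OF S Y]]]
          tangent_nonsmooth[OF vfields_tangent_UNIV[OF lie_bracket_vfields[OF E Y]]]
          tangent_nonsmooth[OF Et])
  qed
qed

end

section \<open>The metric and its Lie derivative\<close>

locale riemannian_manifold = smooth_manifold At
  for At :: "('m::{t2_space,second_countable_topology}, 'e::{real_inner,heine_borel}) chart set" +
  fixes g :: "'m metric"
  assumes metric: "riemannian_metric At g"
begin

lemma metric_linear_right: "v \<in> tangent_space At p \<Longrightarrow> tangent_linear At p (g p v)"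
  using metric by (simp add: riemannian_metric_def)

lemma metric_sym: "v \<in> tangent_space At p \<Longrightarrow> w \<in> tangent_space At p \<Longrightarrow> g p v w = g p w v"
  using metric by (simp add: riemannian_metric_def)

lemma metric_linear_left:
  assumes "w \<in> tangent_space At p"
  shows "tangent_linear At p (\<lambda>v. g p v w)"
  unfolding tangent_linear_def
proof (intro ballI allI)
  fix v u a b assume "v \<in> tangent_space At p" "u \<in> tangent_space At p"
  then show "g p (\<lambda>f. a * v f + b * u f) w = a *\<^sub>R g p v w + b *\<^sub>R g p u w"
    using tangent_linear_lincomb[OF metric_linear_right[OF assms], of v u a b]
    by (simp add: metric_sym[OF _ assms] tangent_lincomb)
qed

text \<open>The Leibniz rule for the Lie derivative of \<open>g\<close> along a combination of
  fields that is valid near one point. The derivatives of \<open>\<sigma> a\<close> appear with a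
  plus sign because brackets enter the Lie derivative negatively and
  \<open>lie_bracket_expansion\<close> contributes another minus.\<close>

lemma lie_derivative_expansion:
  assumes S: "S \<in> vfields At UNIV" and Y: "Y \<in> vfields At UNIV" and Z: "Z \<in> vfields At UNIV"
    and E: "\<And>a. a < k \<Longrightarrow> E a \<in> vfields At UNIV" and \<sigma>: "\<And>a. a < (k::nat) \<Longrightarrow> smooth_fun At UNIV (\<sigma> a)"
    and U: "open U" "p \<in> U" "\<And>q. q \<in> U \<Longrightarrow> S q = (\<lambda>h. \<Sum>a<k. \<sigma> a q * E a q h)"
  shows "lie_derivative_metric S g Y Z p =
    (\<Sum>a<k. \<sigma> a p * lie_derivative_metric (E a) g Y Z p
       + Y p (\<sigma> a) * g p (E a p) (Z p) + Z p (\<sigma> a) * g p (E a p) (Y p))"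
proof -
  note t = vfields_tangent_UNIV
  have b: "lie_bracket S Y p = (\<lambda>h. \<Sum>a<k. \<sigma> a p * lie_bracket (E a) Y p h - Y p (\<sigma> a) * E a p h)"
    "lie_bracket S Z p = (\<lambda>h. \<Sum>a<k. \<sigma> a p * lie_bracket (E a) Z p h - Z p (\<sigma> a) * E a p h)"
    by (rule lie_bracket_expansion[OF S Y E \<sigma> U] lie_bracket_expansion[OF S Z E \<sigma> U]; assumption)+
  have 1: "g p (lie_bracket S Y p) (Z p) =
      (\<Sum>a<k. \<sigma> a p * g p (lie_bracket (E a) Y p) (Z p) - Y p (\<sigma> a) * g p (E a p) (Z p))"
    unfolding b(1)
    using tangent_linear_sum_diff[OF metric_linear_left[where w = "Z p" and p = p, OF t[OF Z]],
        where n = k and v = "\<lambda>a. lie_bracket (E a) Y p" and w = "\<lambda>a. E a p" and c = "\<lambda>a. \<sigma> a p"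
          and d = "\<lambda>a. Y p (\<sigma> a)"]
    by (simp add: t[OF E] t[OF lie_bracket_vfields[OF E Y]])
  have 2: "g p (Y p) (lie_bracket S Z p) =
      (\<Sum>a<k. \<sigma> a p * g p (Y p) (lie_bracket (E a) Z p) - Z p (\<sigma> a) * g p (Y p) (E a p))"
    unfolding b(2)
    using tangent_linear_sum_diff[OF metric_linear_right[where v = "Y p" and p = p, OF t[OF Y]],
        where n = k and v = "\<lambda>a. lie_bracket (E a) Z p" and w = "\<lambda>a. E a p" and c = "\<lambda>a. \<sigma> a p"
          and d = "\<lambda>a. Z p (\<sigma> a)"]
    by (simp add: t[OF E] t[OF lie_bracket_vfields[OF E Z]])
  have "g p (Y p) (E a p) = g p (E a p) (Y p)" if "a < k" for a
    by (rule metric_sym[OF t[OF Y] t[OF E[OF that]]])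
  then show ?thesis
    unfolding lie_derivative_metric_def 1 2
    unfolding U(3)[OF U(2)] sum_subtractf[symmetric]
    by (intro sum.cong refl) (simp add: algebra_simps)
qed

end

section \<open>Vector bundles and local frames\<close>

text \<open>Common source of the sum rules for fibre coordinates, for the anchor and for its
  contraction with the metric; all three are linear on the fibre only, not on the ambient
  space.\<close>

lemma subspace_linear_sum:
  fixes H :: "'v::real_vector \<Rightarrow> real"
  assumes S: "subspace S"
    and H: "\<And>x y a b. x \<in> S \<Longrightarrow> y \<in> S \<Longrightarrow> H (a *\<^sub>R x + b *\<^sub>R y) = a * H x + b * H y"
  shows "(\<And>i. i < n \<Longrightarrow> x i \<in> S) \<Longrightarrow> H (\<Sum>i<n::nat. c i *\<^sub>R x i) = (\<Sum>i<n. c i * H (x i))"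
proof (induction n)
  case 0
  then show ?case using H[of 0 0 0 0] subspace_0[OF S] by simp
next
  case (Suc n)
  have "(\<Sum>i<n. c i *\<^sub>R x i) \<in> S"
    using Suc.prems by (intro subspace_sum[OF S] subspace_scale[OF S]) simp
  then show ?case
    using H[of "\<Sum>i<n. c i *\<^sub>R x i" "x n" 1 "c n"] Suc by simp
qed

lemma tangent_linear_eval: "tangent_linear At p (\<lambda>v. v f *\<^sub>R x)"
  by (simp add: tangent_linear_def algebra_simps)

lemma tangent_linear_form: "tangent_linear At p L \<Longrightarrow> tangent_linear At p (\<lambda>v. L v *\<^sub>R x)"
  by (simp add: tangent_linear_def algebra_simps)

lemma tangent_linear_scale: "tangent_linear At p L \<Longrightarrow> tangent_linear At p (\<lambda>v. c *\<^sub>R L v)"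
  by (simp add: tangent_linear_def algebra_simps)

lemma tangent_linear_add:
  "tangent_linear At p L \<Longrightarrow> tangent_linear At p K \<Longrightarrow> tangent_linear At p (\<lambda>v. L v + K v)"
  by (simp add: tangent_linear_def algebra_simps)

lemma tangent_linear_sum:
  "(\<And>i. i \<in> I \<Longrightarrow> tangent_linear At p (L i)) \<Longrightarrow> tangent_linear At p (\<lambda>v. \<Sum>i\<in>I. L i v)"
  by (simp add: tangent_linear_def sum.distrib scaleR_sum_right)

lemma compact_closure_subset:
  fixes S K :: "'a::t2_space set"
  assumes "S \<subseteq> K" "compact K"
  shows "compact (closure S)"
proof -
  have "closure S \<subseteq> K"
    using assms by (intro closure_minimal compact_imp_closed)
  then show ?thesis
    using compact_Int_closed[OF assms(2) closed_closure[of S]] by (simp add: Int_absorb1)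
qed

locale smooth_vector_bundle = smooth_manifold At
  for At :: "('m::{t2_space,second_countable_topology}, 'e::{real_inner,heine_borel}) chart set" +
  fixes A :: "('m, 'v::real_vector) vbundle"
  assumes vector_bundle: "vector_bundle At A"
begin

lemma fibre_subspace: "subspace (fibre A p)"
  using vector_bundle by (simp add: vector_bundle_def)

lemma triv_cover: obtains U k \<phi> where "(U, k, \<phi>) \<in> trivs A" "p \<in> U"
proof -
  have "p \<in> (\<Union>(U, k, \<phi>)\<in>trivs A. U)"
    using vector_bundle by (simp add: vector_bundle_def)
  then show thesis using that by force
qed

lemma triv:
  assumes "(U, k, \<phi>) \<in> trivs A"
  shows triv_open: "open U"
    and triv_bij: "p \<in> U \<Longrightarrow> bij_betw (\<phi> p) (fibre A p) (coord_space k)"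
    and triv_linear: "p \<in> U \<Longrightarrow> x \<in> fibre A p \<Longrightarrow> y \<in> fibre A p \<Longrightarrow>
      \<phi> p (a *\<^sub>R x + b *\<^sub>R y) i = a * \<phi> p x i + b * \<phi> p y i"
proof -
  have "\<forall>(U, k, \<phi>)\<in>trivs A. open U \<and>
        (\<forall>p\<in>U. bij_betw (\<phi> p) (fibre A p) (coord_space k) \<and>
           (\<forall>x\<in>fibre A p. \<forall>y\<in>fibre A p. \<forall>a b i.
              \<phi> p (a *\<^sub>R x + b *\<^sub>R y) i = a * \<phi> p x i + b * \<phi> p y i))"
    using vector_bundle unfolding vector_bundle_def by (elim conjE)
  from bspec[OF this assms] show "open U"
    "p \<in> U \<Longrightarrow> bij_betw (\<phi> p) (fibre A p) (coord_space k)"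
    "p \<in> U \<Longrightarrow> x \<in> fibre A p \<Longrightarrow> y \<in> fibre A p \<Longrightarrow>
      \<phi> p (a *\<^sub>R x + b *\<^sub>R y) i = a * \<phi> p x i + b * \<phi> p y i"
    by simp_all
qed

lemma triv_transition:
  assumes "(U, k, \<phi>) \<in> trivs A" "(V, l, \<psi>) \<in> trivs A"
  obtains \<tau> where "\<And>j i. j < l \<Longrightarrow> i < k \<Longrightarrow> smooth_fun At (U \<inter> V) (\<tau> j i)"
    "\<And>p x j. p \<in> U \<inter> V \<Longrightarrow> x \<in> fibre A p \<Longrightarrow> j < l \<Longrightarrow> \<psi> p x j = (\<Sum>i<k. \<tau> j i p * \<phi> p x i)"
proof -
  have "\<forall>(U, k, \<phi>)\<in>trivs A. \<forall>(V, l, \<psi>)\<in>trivs A. \<exists>\<tau>.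
        (\<forall>j<l. \<forall>i<k. smooth_fun At (U \<inter> V) (\<tau> j i)) \<and>
        (\<forall>p\<in>U \<inter> V. \<forall>x\<in>fibre A p. \<forall>j<l. \<psi> p x j = (\<Sum>i<k. \<tau> j i p * \<phi> p x i))"
    using vector_bundle unfolding vector_bundle_def by (elim conjE)
  from bspec[OF this assms(1)] have "\<forall>(V, l, \<psi>)\<in>trivs A. \<exists>\<tau>.
        (\<forall>j<l. \<forall>i<k. smooth_fun At (U \<inter> V) (\<tau> j i)) \<and>
        (\<forall>p\<in>U \<inter> V. \<forall>x\<in>fibre A p. \<forall>j<l. \<psi> p x j = (\<Sum>i<k. \<tau> j i p * \<phi> p x i))"
    by simp
  from bspec[OF this assms(2)] obtain \<tau> where
    "\<forall>j<l. \<forall>i<k. smooth_fun At (U \<inter> V) (\<tau> j i)"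
    "\<forall>p\<in>U \<inter> V. \<forall>x\<in>fibre A p. \<forall>j<l. \<psi> p x j = (\<Sum>i<k. \<tau> j i p * \<phi> p x i)"
    unfolding prod.case by (elim exE conjE)
  then show thesis using that[of \<tau>] by simp
qed

lemma triv_sum:
  "(U, k, \<phi>) \<in> trivs A \<Longrightarrow> p \<in> U \<Longrightarrow> (\<And>i. i < n \<Longrightarrow> x i \<in> fibre A p) \<Longrightarrow>
    \<phi> p (\<Sum>i<n::nat. c i *\<^sub>R x i) j = (\<Sum>i<n. c i * \<phi> p (x i) j)"
  by (rule subspace_linear_sum[OF fibre_subspace[of p]]) (simp_all add: triv_linear)

lemma triv_zero: "(U, k, \<phi>) \<in> trivs A \<Longrightarrow> p \<in> U \<Longrightarrow> \<phi> p 0 j = 0"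
  using triv_sum[of U k \<phi> p 0] by simp

lemma triv_scale:
  "(U, k, \<phi>) \<in> trivs A \<Longrightarrow> p \<in> U \<Longrightarrow> x \<in> fibre A p \<Longrightarrow> \<phi> p (c *\<^sub>R x) j = c * \<phi> p x j"
  using triv_linear[of U k \<phi> p x x c 0 j] by simp

lemma triv_add:
  "(U, k, \<phi>) \<in> trivs A \<Longrightarrow> p \<in> U \<Longrightarrow> x \<in> fibre A p \<Longrightarrow> y \<in> fibre A p \<Longrightarrow>
    \<phi> p (x + y) j = \<phi> p x j + \<phi> p y j"
  using triv_linear[of U k \<phi> p x y 1 1 j] by simp

lemma section_fibre: "s \<in> sections At A \<Longrightarrow> s p \<in> fibre A p"
  by (simp add: sections_def)

lemma section_smooth:
  assumes "s \<in> sections At A" "(U, k, \<phi>) \<in> trivs A" "i < k"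
  shows "smooth_fun At U (\<lambda>p. \<phi> p (s p) i)"
proof -
  have "\<forall>(U, k, \<phi>)\<in>trivs A. \<forall>i<k. smooth_fun At U (\<lambda>p. \<phi> p (s p) i)"
    using assms(1) by (simp add: sections_def)
  from bspec[OF this assms(2)] assms(3) show ?thesis by simp
qed

lemma sectionsI:
  assumes "\<And>p. s p \<in> fibre A p"
    and "\<And>U k \<phi> i. (U, k, \<phi>) \<in> trivs A \<Longrightarrow> i < k \<Longrightarrow> smooth_fun At U (\<lambda>p. \<phi> p (s p) i)"
  shows "s \<in> sections At A"
  unfolding sections_def mem_Collect_eq
proof (intro conjI allI assms(1) ballI)
  fix x assume "x \<in> trivs A"
  then show "case x of (U, k, \<phi>) \<Rightarrow> \<forall>i<k. smooth_fun At U (\<lambda>p. \<phi> p (s p) i)"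
    using assms(2) by (cases x) simp
qed

lemma sections_scale:
  assumes "smooth_fun At UNIV f" "s \<in> sections At A"
  shows "(\<lambda>p. f p *\<^sub>R s p) \<in> sections At A"
proof (rule sectionsI)
  show "f p *\<^sub>R s p \<in> fibre A p" for p
    by (rule subspace_scale[OF fibre_subspace section_fibre[OF assms(2)]])
  fix U k \<phi> i assume t: "(U, k, \<phi>) \<in> trivs A" and i: "i < k"
  show "smooth_fun At U (\<lambda>p. \<phi> p (f p *\<^sub>R s p) i)"
    by (rule smooth_fun_cong[OF triv_open[OF t] _
          smooth_fun_mult[OF smooth_fun_subset[OF assms(1) subset_UNIV] section_smooth[OF assms(2) t i]]])
       (simp add: triv_scale[OF t] section_fibre[OF assms(2)])
qed

lemma sections_add:
  assumes "s \<in> sections At A" "t \<in> sections At A"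
  shows "(\<lambda>p. s p + t p) \<in> sections At A"
proof (rule sectionsI)
  show "s p + t p \<in> fibre A p" for p
    by (rule subspace_add[OF fibre_subspace section_fibre[OF assms(1)] section_fibre[OF assms(2)]])
  fix U k \<phi> i assume t: "(U, k, \<phi>) \<in> trivs A" and i: "i < k"
  show "smooth_fun At U (\<lambda>p. \<phi> p (s p + t p) i)"
    by (rule smooth_fun_cong[OF triv_open[OF t] _
          smooth_fun_add[OF section_smooth[OF assms(1) t i] section_smooth[OF assms(2) t i]]])
       (simp add: triv_add[OF t] section_fibre[OF assms(1)] section_fibre[OF assms(2)])
qed

lemma sections_locally_finite_sum:
  assumes s: "\<And>i. s i \<in> sections At A" and f: "\<And>i. smooth_fun At UNIV (f i)"
    and N: "\<And>i p. i \<ge> N p \<Longrightarrow> f i p = 0"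
      "\<And>p. \<exists>W (n::nat). open W \<and> p \<in> W \<and> (\<forall>q\<in>W. N q \<le> n)"
  shows "(\<lambda>p. \<Sum>i<N p. f i p *\<^sub>R s i p) \<in> sections At A"
proof (rule sectionsI)
  show "(\<Sum>i<N p. f i p *\<^sub>R s i p) \<in> fibre A p" for p
    by (intro subspace_sum[OF fibre_subspace] subspace_scale[OF fibre_subspace] section_fibre[OF s])
  fix U k \<phi> j assume t: "(U, k, \<phi>) \<in> trivs A" and j: "j < k"
  have "smooth_fun At U (\<lambda>p. \<Sum>i<N p. f i p * \<phi> p (s i p) j)"
  proof (rule smooth_fun_locally_finite_sum[OF triv_open[OF t]])
    show "smooth_fun At U (\<lambda>p. f i p * \<phi> p (s i p) j)" for i
      by (rule smooth_fun_mult[OF smooth_fun_subset[OF f subset_UNIV] section_smooth[OF s t j]])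
    show "f i p * \<phi> p (s i p) j = 0" if "i \<ge> N p" for i p
      using N(1)[OF that] by simp
  qed (rule N(2))
  then show "smooth_fun At U (\<lambda>p. \<phi> p (\<Sum>i<N p. f i p *\<^sub>R s i p) j)"
    by (rule smooth_fun_cong[OF triv_open[OF t], rotated]) (simp add: triv_sum[OF t] section_fibre[OF s])
qed

lemma sections_zero: "(\<lambda>p. 0) \<in> sections At A"
proof (rule sectionsI)
  fix U k \<phi> i assume t: "(U, k, \<phi>) \<in> trivs A"
  show "smooth_fun At U (\<lambda>p. \<phi> p 0 i)"
    by (rule smooth_fun_cong[OF triv_open[OF t] _ smooth_fun_const[of _ 0]]) (simp add: triv_zero[OF t])
qed (simp add: subspace_0[OF fibre_subspace])

lemma sections_sum:
  "(\<And>i. i < n \<Longrightarrow> s i \<in> sections At A) \<Longrightarrow> (\<lambda>p. \<Sum>i<n::nat. s i p) \<in> sections At A"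
proof (induction n)
  case 0
  show ?case by (simp add: sections_zero)
next
  case (Suc n)
  then show ?case using sections_add[of "\<lambda>p. \<Sum>i<n. s i p" "s n"] by simp
qed

text \<open>Both the frame and the coordinate functions are multiplied by a bump \<open>c\<close>:
  the frame, so that its anchor images lie in the foliation; the coordinates, so that they are
  global functions to which tangent vectors apply. The expansion thus acquires the factor c^2, which
  is 1 on \<open>W\<close>. The algebraic rules for \<open>\<sigma>\<close> hold everywhere.\<close>

lemma local_frame:
  obtains k e \<sigma> W where
    "\<And>a. a < (k::nat) \<Longrightarrow> e a \<in> sections_c At A"
    "\<And>a s. a < k \<Longrightarrow> s \<in> sections At A \<Longrightarrow> smooth_fun At UNIV (\<sigma> a s)"
    "\<And>a s t. a < k \<Longrightarrow> s \<in> sections At A \<Longrightarrow> t \<in> sections At A \<Longrightarrow>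
       \<sigma> a (\<lambda>q. s q + t q) = (\<lambda>q. \<sigma> a s q + \<sigma> a t q)"
    "\<And>a s f. a < k \<Longrightarrow> s \<in> sections At A \<Longrightarrow> \<sigma> a (\<lambda>q. f q *\<^sub>R s q) = (\<lambda>q. f q * \<sigma> a s q)"
    "open W" "p \<in> W"
    "\<And>s q. s \<in> sections At A \<Longrightarrow> q \<in> W \<Longrightarrow> s q = (\<Sum>a<k. \<sigma> a s q *\<^sub>R e a q)"
proof -
  obtain U k \<phi> where t: "(U, k, \<phi>) \<in> trivs A" and "p \<in> U"
    by (rule triv_cover)
  note U = triv_open[OF t] and bij = triv_bij[OF t]
  obtain c W where c: "c \<in> C_inf_c At U" and W: "open W" "p \<in> W" "W \<subseteq> U" "\<And>q. q \<in> W \<Longrightarrow> c q = 1"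
    by (rule bump[OF U \<open>p \<in> U\<close>]) blast
  define d where "d = (\<lambda>q a. inv_into (fibre A q) (\<phi> q) (\<lambda>i. if i = a then 1 else 0))"
  define e where "e = (\<lambda>a q. if q \<in> U then c q *\<^sub>R d q a else 0)"
  define \<sigma> where "\<sigma> = (\<lambda>(a::nat) s q. if q \<in> U then c q * \<phi> q (s q) a else 0)"
  have d: "d q a \<in> fibre A q" "\<phi> q (d q a) i = (if i = a then 1 else 0)" if "q \<in> U" "a < k" for q a i
  proof -
    have "(\<lambda>i. if i = a then 1 else 0) \<in> \<phi> q ` fibre A q"
      using bij_betw_imp_surj_on[OF bij[OF that(1)]] that(2) by (simp add: coord_space_def)
    then show "d q a \<in> fibre A q" "\<phi> q (d q a) i = (if i = a then 1 else 0)"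
      unfolding d_def using inv_into_into[of _ "\<phi> q"] f_inv_into_f[of _ "\<phi> q"] by simp_all
  qed
  have e: "e a \<in> sections_c At A" if a: "a < k" for a
  proof -
    have "e a \<in> sections At A"
    proof (rule sectionsI)
      show "e a q \<in> fibre A q" for q
        using d[of q a] a subspace_0[OF fibre_subspace] subspace_scale[OF fibre_subspace]
        by (simp add: e_def)
      fix V l \<psi> j assume t': "(V, l, \<psi>) \<in> trivs A" and j: "j < l"
      obtain \<tau> where \<tau>: "\<And>j i. j < l \<Longrightarrow> i < k \<Longrightarrow> smooth_fun At (U \<inter> V) (\<tau> j i)"
        "\<And>p x j. p \<in> U \<inter> V \<Longrightarrow> x \<in> fibre A p \<Longrightarrow> j < l \<Longrightarrow> \<psi> p x j = (\<Sum>i<k. \<tau> j i p * \<phi> p x i)"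
        by (rule triv_transition[OF t t']) blast
      \<comment> \<open>In another trivialisation the coordinates of a frame vector are a column of
        the transition matrix, hence smooth.\<close>
      have "\<psi> q (d q a) j = \<tau> j a q" if "q \<in> U" "q \<in> V" for q
      proof -
        have "\<psi> q (d q a) j = (\<Sum>i<k. \<tau> j i q * (if i = a then 1 else 0))"
          using \<tau>(2)[of q "d q a" j] d[OF that(1) a] j that by simp
        then show ?thesis using a by (simp add: if_distrib[of "\<lambda>x. _ * x"] cong: if_cong)
      qed
      then show "smooth_fun At V (\<lambda>q. \<psi> q (e a q) j)"
        by (intro smooth_fun_cong[OF triv_open[OF t'] _
            smooth_fun_extend_zero[OF U c triv_open[OF t'] \<tau>(1)[OF j a]]])
          (simp add: e_def triv_zero[OF t'] triv_scale[OF t'] d(1)[OF _ a])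
    qed
    moreover have "compact (closure {q. e a q \<noteq> 0})"
    proof (rule compact_closure_subset)
      have "{q. e a q \<noteq> 0} \<subseteq> {q. c q \<noteq> 0}" by (auto simp: e_def)
      then show "{q. e a q \<noteq> 0} \<subseteq> closure {q. c q \<noteq> 0}" using closure_subset by (rule order_trans)
      show "compact (closure {q. c q \<noteq> 0})" using c by (simp add: C_inf_c_def)
    qed
    ultimately show ?thesis by (simp add: sections_c_def)
  qed
  have exp: "s q = (\<Sum>a<k. \<sigma> a s q *\<^sub>R e a q)" if s: "s \<in> sections At A" and q: "q \<in> W" for s q
  proof -
    have qU: "q \<in> U" using q W(3) by blast
    note sq = section_fibre[OF s, of q]
    let ?y = "\<Sum>a<k. \<phi> q (s q) a *\<^sub>R d q a"
    have y: "?y \<in> fibre A q"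
      using d[OF qU] by (intro subspace_sum[OF fibre_subspace] subspace_scale[OF fibre_subspace]) simp
    \<comment> \<open>Vectors of the fibre are compared through the injective
      \<open>\<phi> q\<close>. Indices from \<open>k\<close> on must be treated too; there both
      coordinates vanish by \<open>coord_space\<close>.\<close>
    have "\<phi> q ?y i = \<phi> q (s q) i" for i
    proof (cases "i < k")
      case True
      have "\<phi> q ?y i = (\<Sum>a<k. \<phi> q (s q) a * (if i = a then 1 else 0))"
        using triv_sum[OF t qU, of k "d q"] d[OF qU] by simp
      then show ?thesis using True by (simp add: if_distrib[of "\<lambda>x. _ * x"] cong: if_cong)
    next
      case False
      then show ?thesis
        using bij_betwE[OF bij[OF qU]] y sq by (simp add: coord_space_def)
    qed
    then have "?y = s q"
      using bij_betw_imp_inj_on[OF bij[OF qU]] y sq by (metis ext inj_onD)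
    then show ?thesis
      using qU W(4)[OF q] by (simp add: e_def \<sigma>_def)
  qed
  show thesis
  proof (rule that[of k e \<sigma> W])
    show "smooth_fun At UNIV (\<sigma> a s)" if "a < k" "s \<in> sections At A" for a s
      unfolding \<sigma>_def
      by (rule smooth_fun_extend_zero[OF U c open_UNIV]) (simp add: section_smooth[OF that(2) t that(1)])
    show "\<sigma> a (\<lambda>q. s q + t q) = (\<lambda>q. \<sigma> a s q + \<sigma> a t q)"
      if "s \<in> sections At A" "t \<in> sections At A" for a s t
      by (rule ext)
         (simp add: \<sigma>_def triv_add[OF \<open>(U, k, \<phi>) \<in> trivs A\<close>] section_fibre that distrib_left)
    show "\<sigma> a (\<lambda>q. f q *\<^sub>R s q) = (\<lambda>q. f q * \<sigma> a s q)" if "s \<in> sections At A" for a s f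
      by (rule ext) (simp add: \<sigma>_def triv_scale[OF t] section_fibre that)
  qed (fact e W exp)+
qed

end

section \<open>Gluing metric connections\<close>

text \<open>A connection multiplied by \<open>b\<close>: an operator with symbol \<open>b\<close>, for which the metric condition reads
  \<open>b * L\<^bsub>\<rho>(s)\<^esub> g\<close>. Unlike connections, these can be cut off and added.\<close>

definition weighted_connection ::
  "('m::topological_space, 'e::real_normed_vector) chart set \<Rightarrow> ('m, 'v::real_vector) vbundle \<Rightarrow>
   ('m \<Rightarrow> 'v \<Rightarrow> 'm tvec) \<Rightarrow> 'm metric \<Rightarrow> ('m \<Rightarrow> real) \<Rightarrow>
   (('m \<Rightarrow> 'v) \<Rightarrow> 'm \<Rightarrow> 'm tvec \<Rightarrow> 'v) \<Rightarrow> bool" where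
  "weighted_connection At A \<rho> g b D \<longleftrightarrow>
     (\<forall>s\<in>sections At A.
        (\<forall>p. tangent_linear At p (D s p) \<and> (\<forall>v\<in>tangent_space At p. D s p v \<in> fibre A p)) \<and>
        (\<forall>X\<in>vfields At UNIV. (\<lambda>p. D s p (X p)) \<in> sections At A) \<and>
        (\<forall>t\<in>sections At A. \<forall>p. \<forall>v\<in>tangent_space At p.
           D (\<lambda>q. s q + t q) p v = D s p v + D t p v) \<and>
        (\<forall>f\<in>C_inf At. \<forall>p. \<forall>v\<in>tangent_space At p.
           D (\<lambda>q. f q *\<^sub>R s q) p v = (b p * v f) *\<^sub>R s p + f p *\<^sub>R D s p v) \<and>
        (\<forall>Y\<in>vfields At UNIV. \<forall>Z\<in>vfields At UNIV. \<forall>p.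
           g p (\<rho> p (D s p (Y p))) (Z p) + g p (\<rho> p (D s p (Z p))) (Y p)
             = b p * lie_derivative_metric (anchor_on \<rho> s) g Y Z p))"

lemma
  assumes "weighted_connection At A \<rho> g b D" "s \<in> sections At A"
  shows weighted_connection_linear: "tangent_linear At p (D s p)"
    and weighted_connection_fibre: "v \<in> tangent_space At p \<Longrightarrow> D s p v \<in> fibre A p"
    and weighted_connection_section: "X \<in> vfields At UNIV \<Longrightarrow> (\<lambda>p. D s p (X p)) \<in> sections At A"
    and weighted_connection_add: "t \<in> sections At A \<Longrightarrow> v \<in> tangent_space At p \<Longrightarrow>
      D (\<lambda>q. s q + t q) p v = D s p v + D t p v"
    and weighted_connection_scale: "f \<in> C_inf At \<Longrightarrow> v \<in> tangent_space At p \<Longrightarrow>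
      D (\<lambda>q. f q *\<^sub>R s q) p v = (b p * v f) *\<^sub>R s p + f p *\<^sub>R D s p v"
    and weighted_connection_metric: "Y \<in> vfields At UNIV \<Longrightarrow> Z \<in> vfields At UNIV \<Longrightarrow>
      g p (\<rho> p (D s p (Y p))) (Z p) + g p (\<rho> p (D s p (Z p))) (Y p)
        = b p * lie_derivative_metric (anchor_on \<rho> s) g Y Z p"
  using bspec[OF assms(1)[unfolded weighted_connection_def] assms(2)] by simp_all

locale anchored_bundle = riemannian_manifold At g + smooth_vector_bundle At A
  for At :: "('m::{t2_space,second_countable_topology}, 'e::{real_inner,heine_borel}) chart set"
    and g :: "'m metric" and A :: "('m, 'v::real_vector) vbundle" +
  fixes \<rho> :: "'m \<Rightarrow> 'v \<Rightarrow> 'm tvec"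
  assumes anchor: "anchor_map At A \<rho>"
begin

lemma anchor_tangent: "x \<in> fibre A p \<Longrightarrow> \<rho> p x \<in> tangent_space At p"
  and anchor_linear: "x \<in> fibre A p \<Longrightarrow> y \<in> fibre A p \<Longrightarrow>
    \<rho> p (a *\<^sub>R x + b *\<^sub>R y) = (\<lambda>f. a * \<rho> p x f + b * \<rho> p y f)"
  using anchor by (simp_all add: anchor_map_def)

lemma anchor_sum:
  assumes "\<And>i. i < n \<Longrightarrow> x i \<in> fibre A p"
  shows "\<rho> p (\<Sum>i<n::nat. c i *\<^sub>R x i) = (\<lambda>f. \<Sum>i<n. c i * \<rho> p (x i) f)"
  by (rule ext, rule subspace_linear_sum[OF fibre_subspace[of p]]) (simp_all add: anchor_linear assms)

lemma metric_anchor_linear: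
  "w \<in> tangent_space At p \<Longrightarrow> x \<in> fibre A p \<Longrightarrow> y \<in> fibre A p \<Longrightarrow>
    g p (\<rho> p (a *\<^sub>R x + b *\<^sub>R y)) w = a * g p (\<rho> p x) w + b * g p (\<rho> p y) w"
  using tangent_linear_lincomb[OF metric_linear_left[of w p] anchor_tangent anchor_tangent, of x y a b]
  by (simp add: anchor_linear)

lemma metric_anchor_sum:
  assumes "w \<in> tangent_space At p" "\<And>i. i < n \<Longrightarrow> x i \<in> fibre A p"
  shows "g p (\<rho> p (\<Sum>i<n::nat. c i *\<^sub>R x i)) w = (\<Sum>i<n. c i * g p (\<rho> p (x i)) w)"
  by (rule subspace_linear_sum[OF fibre_subspace[of p]])
     (simp_all add: metric_anchor_linear[OF assms(1)] assms(2))

lemma metric_anchor_scale: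
  "w \<in> tangent_space At p \<Longrightarrow> x \<in> fibre A p \<Longrightarrow> g p (\<rho> p (a *\<^sub>R x)) w = a * g p (\<rho> p x) w"
  using metric_anchor_linear[of w p x x a 0] by simp

lemma anchor_on_vfields:
  assumes s: "s \<in> sections At A"
  shows "anchor_on \<rho> s \<in> vfields At UNIV"
proof (rule vfieldsI)
  show "anchor_on \<rho> s p \<in> tangent_space At p" for p
    by (simp add: anchor_on_def anchor_tangent section_fibre[OF s])
  fix f assume f: "smooth_fun At UNIV f"
  show "smooth_fun At UNIV (\<lambda>p. anchor_on \<rho> s p f)"
  proof (rule smooth_fun_locally[OF open_UNIV])
    fix p
    obtain U k \<phi> where t: "(U, k, \<phi>) \<in> trivs A" "p \<in> U" by (rule triv_cover)
    have "\<forall>(U, k, \<phi>)\<in>trivs A. \<exists>X. (\<forall>i<k. X i \<in> vfields At U) \<and>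
        (\<forall>p\<in>U. \<forall>x\<in>fibre A p. \<rho> p x = (\<lambda>f. \<Sum>i<k. \<phi> p x i * X i p f))"
      using anchor unfolding anchor_map_def by (elim conjE)
    from bspec[OF this t(1)] obtain X where X: "\<forall>i<k. X i \<in> vfields At U"
      "\<forall>p\<in>U. \<forall>x\<in>fibre A p. \<rho> p x = (\<lambda>f. \<Sum>i<k. \<phi> p x i * X i p f)"
      unfolding prod.case by (elim exE conjE)
    have "smooth_fun At U (\<lambda>q. \<Sum>i<k. \<phi> q (s q) i * X i q f)"
      using X(1) by (intro smooth_fun_sum smooth_fun_mult section_smooth[OF s t(1)] vfields_smooth[OF _ f])
        simp_all
    then have "smooth_fun At U (\<lambda>p. anchor_on \<rho> s p f)"
      by (rule smooth_fun_cong[OF triv_open[OF t(1)], rotated])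
         (simp add: anchor_on_def X(2)[rule_format, OF _ section_fibre[OF s]])
    then show "\<exists>W. open W \<and> p \<in> W \<and> smooth_fun At (UNIV \<inter> W) (\<lambda>p. anchor_on \<rho> s p f)"
      using triv_open[OF t(1)] t(2) by (intro exI[of _ U] conjI) simp_all
  qed
qed

text \<open>Each clause is linear in the pair of weight and operator, also with functions as
  coefficients, so multiplying by \<open>\<psi> i\<close> and adding gives an operator of weight
  \<open>\<Sum>i. \<psi> i * b i\<close>, which is 1.\<close>

lemma weighted_connection_glue:
  assumes D: "\<And>i. weighted_connection At A \<rho> g (b i) (D i)"
    and \<psi>: "\<And>i. smooth_fun At UNIV (\<psi> i)" "\<And>p. (\<Sum>i<N p. \<psi> i p * b i p) = 1"
      "\<And>i p. i \<ge> N p \<Longrightarrow> \<psi> i p = 0"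
      "\<And>p. \<exists>U (n::nat). open U \<and> p \<in> U \<and> (\<forall>q\<in>U. N q \<le> n)"
  shows "weighted_connection At A \<rho> g (\<lambda>p. 1) (\<lambda>s p v. \<Sum>i<N p. \<psi> i p *\<^sub>R D i s p v)"
  unfolding weighted_connection_def
proof (intro ballI conjI allI)
  fix s p assume s: "s \<in> sections At A"
  note D1 = weighted_connection_linear[OF D s] and D2 = weighted_connection_fibre[OF D s]
    and D3 = weighted_connection_section[OF D s]
  show "tangent_linear At p (\<lambda>v. \<Sum>i<N p. \<psi> i p *\<^sub>R D i s p v)"
    by (intro tangent_linear_sum tangent_linear_scale D1)
  show "(\<Sum>i<N p. \<psi> i p *\<^sub>R D i s p v) \<in> fibre A p" if "v \<in> tangent_space At p" for v
    by (intro subspace_sum[OF fibre_subspace] subspace_scale[OF fibre_subspace] D2[OF that])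
  show "(\<lambda>p. \<Sum>i<N p. \<psi> i p *\<^sub>R D i s p (X p)) \<in> sections At A" if X: "X \<in> vfields At UNIV" for X
    by (rule sections_locally_finite_sum[where f = \<psi>]) (fact D3[OF X] \<psi>)+
  show "(\<Sum>i<N p. \<psi> i p *\<^sub>R D i (\<lambda>q. s q + t q) p v) =
      (\<Sum>i<N p. \<psi> i p *\<^sub>R D i s p v) + (\<Sum>i<N p. \<psi> i p *\<^sub>R D i t p v)"
    if "t \<in> sections At A" "v \<in> tangent_space At p" for t v
    by (simp add: weighted_connection_add[OF D s that] scaleR_add_right sum.distrib)
  show "(\<Sum>i<N p. \<psi> i p *\<^sub>R D i (\<lambda>q. f q *\<^sub>R s q) p v) =
      (1 * v f) *\<^sub>R s p + f p *\<^sub>R (\<Sum>i<N p. \<psi> i p *\<^sub>R D i s p v)"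
    if "f \<in> C_inf At" "v \<in> tangent_space At p" for f v
  proof -
    have "(\<Sum>i<N p. \<psi> i p *\<^sub>R D i (\<lambda>q. f q *\<^sub>R s q) p v) =
        (\<Sum>i<N p. (\<psi> i p * b i p) *\<^sub>R (v f *\<^sub>R s p)) + (\<Sum>i<N p. f p *\<^sub>R (\<psi> i p *\<^sub>R D i s p v))"
      unfolding sum.distrib[symmetric]
      by (rule sum.cong[OF refl])
         (simp add: weighted_connection_scale[OF D s that] scaleR_add_right mult_ac)
    then show ?thesis
      unfolding scaleR_sum_left[symmetric] scaleR_sum_right[symmetric] \<psi>(2) by simp
  qed
  show "g p (\<rho> p (\<Sum>i<N p. \<psi> i p *\<^sub>R D i s p (Y p))) (Z p)
      + g p (\<rho> p (\<Sum>i<N p. \<psi> i p *\<^sub>R D i s p (Z p))) (Y p)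
      = 1 * lie_derivative_metric (anchor_on \<rho> s) g Y Z p"
    if Y: "Y \<in> vfields At UNIV" and Z: "Z \<in> vfields At UNIV" for Y Z
  proof -
    note t = vfields_tangent_UNIV
    have "g p (\<rho> p (\<Sum>i<N p. \<psi> i p *\<^sub>R D i s p (Y p))) (Z p)
      + g p (\<rho> p (\<Sum>i<N p. \<psi> i p *\<^sub>R D i s p (Z p))) (Y p)
      = (\<Sum>i<N p. \<psi> i p * (g p (\<rho> p (D i s p (Y p))) (Z p) + g p (\<rho> p (D i s p (Z p))) (Y p)))"
      by (simp add: metric_anchor_sum[OF t[OF Z] D2[OF t[OF Y]]] metric_anchor_sum[OF t[OF Y] D2[OF t[OF Z]]]
          sum.distrib distrib_left)
    also have "\<dots> = (\<Sum>i<N p. \<psi> i p * b i p) * lie_derivative_metric (anchor_on \<rho> s) g Y Z p"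
      by (simp add: weighted_connection_metric[OF D s Y Z] sum_distrib_right mult.assoc)
    finally show ?thesis by (simp add: \<psi>(2))
  qed
qed

text \<open>The induced derivative of \<open>g\<close> along \<open>s\<close> is the Lie derivative
  of \<open>g\<close> along the anchor image of \<open>s\<close> minus the symmetrised form
  \<open>g (\<rho> (D s Y)) Z\<close>. The metric clause with weight 1 says exactly that the two
  agree.\<close>

lemma weighted_connection_one:
  assumes D: "weighted_connection At A \<rho> g (\<lambda>p. 1) D"
  shows "connection At A D" "metric_parallel At A \<rho> D g"
proof -
  show "connection At A D"
    unfolding connection_def
    by (simp add: weighted_connection_linear[OF D] weighted_connection_fibre[OF D]
        weighted_connection_section[OF D] weighted_connection_add[OF D] weighted_connection_scale[OF D])
  show "metric_parallel At A \<rho> D g"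
    unfolding metric_parallel_def
  proof (intro ballI allI)
    fix s Y Z p
    assume s: "s \<in> sections At A" and Y: "Y \<in> vfields At UNIV" and Z: "Z \<in> vfields At UNIV"
    note t = vfields_tangent_UNIV
    have \<rho>t: "\<rho> p (D s p (X p)) \<in> tangent_space At p" if "X \<in> vfields At UNIV" for X
      by (rule anchor_tangent[OF weighted_connection_fibre[OF D s t[OF that]]])
    have bt: "lie_bracket (anchor_on \<rho> s) X p \<in> tangent_space At p" if "X \<in> vfields At UNIV" for X
      by (rule t[OF lie_bracket_vfields[OF anchor_on_vfields[OF s] that]])
    have "g p (A_connection \<rho> D s Y p) (Z p) =
        g p (lie_bracket (anchor_on \<rho> s) Y p) (Z p) + g p (\<rho> p (D s p (Y p))) (Z p)"
      using tangent_linear_lincomb[OF metric_linear_left[OF t[OF Z]] bt[OF Y] \<rho>t[OF Y], of 1 1]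
      by (simp add: A_connection_def)
    moreover have "g p (Y p) (A_connection \<rho> D s Z p) =
        g p (Y p) (lie_bracket (anchor_on \<rho> s) Z p) + g p (\<rho> p (D s p (Z p))) (Y p)"
      using tangent_linear_lincomb[OF metric_linear_right[OF t[OF Y]] bt[OF Z] \<rho>t[OF Z], of 1 1]
      by (simp add: A_connection_def metric_sym[OF t[OF Y] \<rho>t[OF Z]])
    ultimately show "A_connection_metric \<rho> D s g Y Z p = 0"
      using weighted_connection_metric[OF D s Y Z, of p]
      by (simp add: A_connection_metric_def lie_derivative_metric_def)
  qed
qed

section \<open>Metric connections from the module SRF condition\<close>

text \<open>The fields in the decomposition belong to the image of the anchor, so they lift to
  sections \<open>t j\<close>. Any lift will do, since the metric condition sees a connection only
  through the anchor. The lifts become the values of the connection.\<close>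

lemma lie_derivative_forms:
  assumes SRF: "module_SRF At g (anchor_on \<rho> ` sections_c At A)" and s: "s \<in> sections_c At A"
  shows "\<exists>(n::nat) \<omega> t. (\<forall>j<n. one_form At (\<omega> j) \<and> t j \<in> sections At A) \<and>
    (\<forall>Y\<in>vfields At UNIV. \<forall>Z\<in>vfields At UNIV. \<forall>p. lie_derivative_metric (anchor_on \<rho> s) g Y Z p
      = (\<Sum>j<n. \<omega> j p (Y p) * g p (\<rho> p (t j p)) (Z p) + \<omega> j p (Z p) * g p (\<rho> p (t j p)) (Y p)))"
proof -
  let ?F = "anchor_on \<rho> ` sections_c At A"
  have "\<forall>X\<in>?F. \<exists>(N::nat) \<omega> V. (\<forall>i<N. one_form At (\<omega> i) \<and> V i \<in> ?F) \<and>
        (\<forall>Y\<in>vfields At UNIV. \<forall>Z\<in>vfields At UNIV. \<forall>p.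
           lie_derivative_metric X g Y Z p = (\<Sum>i<N. sym_prod (\<omega> i) (flat g (V i)) Y Z p))"
    using SRF unfolding module_SRF_def by (elim conjE)
  from bspec[OF this imageI[OF s]] obtain N :: nat and \<omega> V where
    V: "\<forall>i<N. one_form At (\<omega> i) \<and> V i \<in> ?F" and
    L: "\<forall>Y\<in>vfields At UNIV. \<forall>Z\<in>vfields At UNIV. \<forall>p.
      lie_derivative_metric (anchor_on \<rho> s) g Y Z p = (\<Sum>i<N. sym_prod (\<omega> i) (flat g (V i)) Y Z p)"
    by (elim exE conjE)
  have "\<forall>i. \<exists>t. i < N \<longrightarrow> t \<in> sections At A \<and> V i = anchor_on \<rho> t"
    using V by (auto simp: sections_c_def)
  from choice[OF this] obtain t where
    t: "\<forall>i. i < N \<longrightarrow> t i \<in> sections At A \<and> V i = anchor_on \<rho> (t i)" ..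
  show ?thesis
  proof (intro exI[of _ N] exI[of _ \<omega>] exI[of _ t] conjI allI impI ballI)
    show "one_form At (\<omega> j)" "t j \<in> sections At A" if "j < N" for j
      using V t that by simp_all
    fix Y Z p assume "Y \<in> vfields At UNIV" "Z \<in> vfields At UNIV"
    then show "lie_derivative_metric (anchor_on \<rho> s) g Y Z p =
        (\<Sum>j<N. \<omega> j p (Y p) * g p (\<rho> p (t j p)) (Z p) + \<omega> j p (Z p) * g p (\<rho> p (t j p)) (Y p))"
      using L t by (simp add: sym_prod_def flat_def anchor_on_def)
  qed
qed

lemma local_weighted_connection:
  assumes SRF: "module_SRF At g (anchor_on \<rho> ` sections_c At A)"
  obtains b W D where "smooth_fun At UNIV b" "open W" "p \<in> W" "\<And>q. q \<in> W \<Longrightarrow> b q = 1"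
    "weighted_connection At A \<rho> g b D"
proof -
  obtain k e \<sigma> W where e: "\<And>a. a < (k::nat) \<Longrightarrow> e a \<in> sections_c At A"
    and \<sigma>: "\<And>a s. a < k \<Longrightarrow> s \<in> sections At A \<Longrightarrow> smooth_fun At UNIV (\<sigma> a s)"
      "\<And>a s t. a < k \<Longrightarrow> s \<in> sections At A \<Longrightarrow> t \<in> sections At A \<Longrightarrow>
         \<sigma> a (\<lambda>q. s q + t q) = (\<lambda>q. \<sigma> a s q + \<sigma> a t q)"
      "\<And>a s f. a < k \<Longrightarrow> s \<in> sections At A \<Longrightarrow> \<sigma> a (\<lambda>q. f q *\<^sub>R s q) = (\<lambda>q. f q * \<sigma> a s q)"
    and W: "open W" "p \<in> W"
    and exp: "\<And>s q. s \<in> sections At A \<Longrightarrow> q \<in> W \<Longrightarrow> s q = (\<Sum>a<k. \<sigma> a s q *\<^sub>R e a q)"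
    by (rule local_frame[of p]) blast
  have es: "e a \<in> sections At A" if "a < k" for a
    using e[OF that] by (simp add: sections_c_def)
  define P where "P a n \<omega> t \<longleftrightarrow> (\<forall>j<n. one_form At (\<omega> j) \<and> t j \<in> sections At A) \<and>
    (\<forall>Y\<in>vfields At UNIV. \<forall>Z\<in>vfields At UNIV. \<forall>p. lie_derivative_metric (anchor_on \<rho> (e a)) g Y Z p
      = (\<Sum>j<n. \<omega> j p (Y p) * g p (\<rho> p (t j p)) (Z p) + \<omega> j p (Z p) * g p (\<rho> p (t j p)) (Y p)))"
    for a and n :: nat and \<omega> t
  have "\<exists>n \<omega> t. P a n \<omega> t" if "a < k" for a
    using lie_derivative_forms[OF SRF e[OF that]] unfolding P_def .
  \<comment> \<open>The bound on \<open>a\<close> is moved inside the existential quantifiers so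
    that \<open>choice\<close> applies to all \<open>a\<close>.\<close>
  then have "\<forall>a. \<exists>n \<omega> t. a < k \<longrightarrow> P a n \<omega> t"
    by blast
  from choice[OF this] obtain n where "\<forall>a. \<exists>\<omega> t. a < k \<longrightarrow> P a (n a) \<omega> t" ..
  from choice[OF this] obtain \<omega> where "\<forall>a. \<exists>t. a < k \<longrightarrow> P a (n a) (\<omega> a) t" ..
  from choice[OF this] obtain t where P: "\<forall>a. a < k \<longrightarrow> P a (n a) (\<omega> a) (t a)" ..
  have \<omega>: "tangent_linear At p (\<omega> a j p)"
      "X \<in> vfields At UNIV \<Longrightarrow> smooth_fun At UNIV (\<lambda>p. \<omega> a j p (X p))"
    and t: "t a j \<in> sections At A" if "a < k" "j < n a" for a j p X
    using P that unfolding P_def one_form_def C_inf_iff by simp_all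
  have lie: "lie_derivative_metric (anchor_on \<rho> (e a)) g Y Z p
      = (\<Sum>j<n a. \<omega> a j p (Y p) * g p (\<rho> p (t a j p)) (Z p)
          + \<omega> a j p (Z p) * g p (\<rho> p (t a j p)) (Y p))"
    if "a < k" "Y \<in> vfields At UNIV" "Z \<in> vfields At UNIV" for a Y Z p
    using P that unfolding P_def by simp
  \<comment> \<open>A second bump, supported in the region \<open>W\<close> where the frame
    expansion is exact, hides the failure of that expansion outside.\<close>
  obtain b W' where b: "b \<in> C_inf_c At W" and W': "open W'" "p \<in> W'" "\<And>q. q \<in> W' \<Longrightarrow> b q = 1"
    by (rule bump[OF W]) blast
  note bs = C_inf_c_subset[OF b] and bW = C_inf_c_zero_outside[OF b]
  \<comment> \<open>Prescribing \<Sum>j \<omega> a j \<otimes> t a j as the derivative of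
    \<open>e a\<close> and extending by the Leibniz rule to \<Sum>a \<sigma> a s * e a gives the
    bracketed sum; \<open>b\<close> cuts it off.\<close>
  define D where "D = (\<lambda>s p v. b p *\<^sub>R (\<Sum>a<k. v (\<sigma> a s) *\<^sub>R e a p
      + \<sigma> a s p *\<^sub>R (\<Sum>j<n a. \<omega> a j p v *\<^sub>R t a j p)))"
  note fib = section_fibre[OF es] section_fibre[OF t]
  note sub = subspace_sum[OF fibre_subspace] subspace_scale[OF fibre_subspace]
    subspace_add[OF fibre_subspace]
  have Df: "D s p v \<in> fibre A p" for s p v
    unfolding D_def by (intro sub) (simp_all add: fib)
  have "weighted_connection At A \<rho> g b D"
    unfolding weighted_connection_def
  proof (intro ballI conjI allI)
    fix s p assume s: "s \<in> sections At A"
    show "tangent_linear At p (D s p)"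
      unfolding D_def
      by (intro tangent_linear_sum tangent_linear_scale tangent_linear_add tangent_linear_eval
          tangent_linear_form \<omega>) simp_all
    show "D s p v \<in> fibre A p" for v by (fact Df)
    show "(\<lambda>p. D s p (X p)) \<in> sections At A" if X: "X \<in> vfields At UNIV" for X
      unfolding D_def
      by (intro sections_scale bs sections_sum sections_add es t vfields_smooth[OF X] \<sigma>(1) s \<omega>(2) X) simp_all
    show "D (\<lambda>q. s q + t q) p v = D s p v + D t p v"
      if "t \<in> sections At A" "v \<in> tangent_space At p" for t v
    proof -
      have "v (\<lambda>q. \<sigma> a s q + \<sigma> a t q) = v (\<sigma> a s) + v (\<sigma> a t)" if "a < k" for a
        by (rule tangent_add[OF \<open>v \<in> tangent_space At p\<close> \<sigma>(1)[OF that s] \<sigma>(1)[OF that \<open>t \<in> sections At A\<close>]])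
      then show ?thesis
        unfolding D_def scaleR_add_right[symmetric] sum.distrib[symmetric]
        by (intro arg_cong[where f = "(*\<^sub>R) (b p)"] sum.cong refl)
           (simp add: \<sigma>(2) s that(1) scaleR_add_left)
    qed
    show "D (\<lambda>q. f q *\<^sub>R s q) p v = (b p * v f) *\<^sub>R s p + f p *\<^sub>R D s p v"
      if f: "f \<in> C_inf At" and v: "v \<in> tangent_space At p" for f v
    proof -
      have "v (\<lambda>q. f q * \<sigma> a s q) = v f * \<sigma> a s p + f p * v (\<sigma> a s)" if "a < k" for a
        by (rule tangent_mult[OF v f[unfolded C_inf_iff] \<sigma>(1)[OF that s]])
      then have "D (\<lambda>q. f q *\<^sub>R s q) p v
          = b p *\<^sub>R (v f *\<^sub>R (\<Sum>a<k. \<sigma> a s p *\<^sub>R e a p)) + f p *\<^sub>R D s p v"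
        unfolding D_def scaleR_sum_right[symmetric] scaleR_left_commute[of "f p"]
          scaleR_add_right[symmetric]
        unfolding scaleR_sum_right[of "v f"] scaleR_sum_right[of "f p" _ "{..<k}"] sum.distrib[symmetric]
        by (intro arg_cong[where f = "(*\<^sub>R) (b p)"] sum.cong refl)
           (simp add: \<sigma>(3) s scaleR_add_left scaleR_add_right)
      \<comment> \<open>On \<open>W\<close> the frame expansion identifies the first sum with
        \<open>s p\<close>; elsewhere \<open>b p = 0\<close> removes that term on both
        sides.\<close>
      then show ?thesis
        using exp[OF s, of p] bW[of p] by (cases "p \<in> W") simp_all
    qed
    show "g p (\<rho> p (D s p (Y p))) (Z p) + g p (\<rho> p (D s p (Z p))) (Y p)
        = b p * lie_derivative_metric (anchor_on \<rho> s) g Y Z p"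
      if Y: "Y \<in> vfields At UNIV" and Z: "Z \<in> vfields At UNIV" for Y Z
    proof -
      note tv = vfields_tangent_UNIV
      have gD: "g p (\<rho> p (D s p v)) w = b p * (\<Sum>a<k. v (\<sigma> a s) * g p (\<rho> p (e a p)) w
          + \<sigma> a s p * (\<Sum>j<n a. \<omega> a j p v * g p (\<rho> p (t a j p)) w))"
        if w: "w \<in> tangent_space At p" for v w
      proof -
        have in_fib: "(\<Sum>j<n a. \<omega> a j p v *\<^sub>R t a j p) \<in> fibre A p" if "a < k" for a
          by (intro sub) (simp add: fib that)
        have "g p (\<rho> p (D s p v)) w = b p * (\<Sum>a<k. 1 * g p (\<rho> p (v (\<sigma> a s) *\<^sub>R e a p
            + \<sigma> a s p *\<^sub>R (\<Sum>j<n a. \<omega> a j p v *\<^sub>R t a j p))) w)"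
          unfolding D_def
          by (subst metric_anchor_scale[OF w], intro sub, simp_all add: fib in_fib)
             (subst metric_anchor_sum[OF w, where c = "\<lambda>i. 1", simplified], intro sub, simp_all add: fib in_fib)
        also have "\<dots> = b p * (\<Sum>a<k. v (\<sigma> a s) * g p (\<rho> p (e a p)) w
          + \<sigma> a s p * (\<Sum>j<n a. \<omega> a j p v * g p (\<rho> p (t a j p)) w))"
          by (intro arg_cong[where f = "(*) (b p)"] sum.cong refl)
             (simp add: metric_anchor_linear[OF w] fib in_fib metric_anchor_sum[OF w])
        finally show ?thesis .
      qed
      show ?thesis
      proof (cases "p \<in> W")
        case True
        have E: "anchor_on \<rho> (e a) \<in> vfields At UNIV" if "a < k" for a
          by (rule anchor_on_vfields[OF es[OF that]])
        have S: "anchor_on \<rho> s q = (\<lambda>h. \<Sum>a<k. \<sigma> a s q * anchor_on \<rho> (e a) q h)" if "q \<in> W" for q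
          using anchor_sum[of k "\<lambda>a. e a q" q "\<lambda>a. \<sigma> a s q"] fib(1)
          by (simp add: anchor_on_def exp[OF s that])
        \<comment> \<open>The terms with derivatives of \<open>\<sigma> a s\<close> match the
          Leibniz part of \<open>D\<close>; the Lie derivatives along the frame match the part made
          of \<open>\<omega>\<close> and \<open>t\<close>, by the choice of these data.\<close>
        have "lie_derivative_metric (anchor_on \<rho> s) g Y Z p =
            (\<Sum>a<k. \<sigma> a s p * lie_derivative_metric (anchor_on \<rho> (e a)) g Y Z p
              + Y p (\<sigma> a s) * g p (anchor_on \<rho> (e a) p) (Z p)
              + Z p (\<sigma> a s) * g p (anchor_on \<rho> (e a) p) (Y p))"
          by (rule lie_derivative_expansion[OF anchor_on_vfields[OF s] Y Z E \<sigma>(1)[OF _ s] W(1) True S])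
        then show ?thesis
          unfolding gD[OF tv[OF Z]] gD[OF tv[OF Y]] distrib_left[symmetric] sum.distrib[symmetric]
          by (simp add: anchor_on_def)
             (intro disjI2 sum.cong refl,
               simp add: lie[unfolded anchor_on_def, OF _ Y Z] sum.distrib algebra_simps)
      next
        case False
        then show ?thesis
          unfolding gD[OF tv[OF Z]] gD[OF tv[OF Y]] by (simp add: bW)
      qed
    qed
  qed
  then show thesis
    using that bs W' by blast
qed

lemma metric_connection_exists:
  assumes SRF: "module_SRF At g (anchor_on \<rho> ` sections_c At A)"
  shows "\<exists>nab. connection At A nab \<and> metric_parallel At A \<rho> nab g"
proof -
  have "\<forall>p. \<exists>b W D. smooth_fun At UNIV b \<and> open W \<and> p \<in> W \<and> (\<forall>q\<in>W. b q = 1) \<and>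
      weighted_connection At A \<rho> g b D"
  proof
    fix p
    obtain b W D where "smooth_fun At UNIV b" "open W" "p \<in> W" "\<And>q. q \<in> W \<Longrightarrow> b q = 1"
      "weighted_connection At A \<rho> g b D"
      by (rule local_weighted_connection[OF SRF, of p]) blast
    then show "\<exists>b W D. smooth_fun At UNIV b \<and> open W \<and> p \<in> W \<and> (\<forall>q\<in>W. b q = 1) \<and>
        weighted_connection At A \<rho> g b D"
      by (intro exI[of _ b] exI[of _ W] exI[of _ D] conjI ballI)
  qed
  from choice[OF this] obtain b where "\<forall>p. \<exists>W D. smooth_fun At UNIV (b p) \<and> open W \<and> p \<in> W \<and>
      (\<forall>q\<in>W. b p q = 1) \<and> weighted_connection At A \<rho> g (b p) D" ..
  from choice[OF this] obtain W where "\<forall>p. \<exists>D. smooth_fun At UNIV (b p) \<and> open (W p) \<and> p \<in> W p \<and>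
      (\<forall>q\<in>W p. b p q = 1) \<and> weighted_connection At A \<rho> g (b p) D" ..
  from choice[OF this] obtain D where *: "\<forall>p. smooth_fun At UNIV (b p) \<and> open (W p) \<and> p \<in> W p \<and>
      (\<forall>q\<in>W p. b p q = 1) \<and> weighted_connection At A \<rho> g (b p) (D p)" ..
  then have b: "\<And>p. smooth_fun At UNIV (b p)" "\<And>p. open (W p)" "\<And>p. p \<in> W p"
      "\<And>p. \<forall>q\<in>W p. b p q = 1" and D: "\<And>p. weighted_connection At A \<rho> g (b p) (D p)"
    by simp_all
  show ?thesis
  proof (rule partition_of_unity[OF b(1-3) bspec[OF b(4)]])
    fix x :: "nat \<Rightarrow> 'm" and \<psi> :: "nat \<Rightarrow> 'm \<Rightarrow> real" and N :: "'m \<Rightarrow> nat"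
    assume \<psi>: "\<And>i. smooth_fun At UNIV (\<psi> i)" "\<And>p. (\<Sum>i<N p. \<psi> i p * b (x i) p) = 1"
      "\<And>i p. N p \<le> i \<Longrightarrow> \<psi> i p = 0" "\<And>p. \<exists>U n. open U \<and> p \<in> U \<and> (\<forall>q\<in>U. N q \<le> n)"
    show ?thesis
      using weighted_connection_one[OF weighted_connection_glue[where b = "\<lambda>i. b (x i)"
            and D = "\<lambda>i. D (x i)" and \<psi> = \<psi> and N = N, OF D \<psi>]] by (intro exI conjI)
  qed
qed

end

section \<open>The almost Lie algebroid of a finitely generated foliation\<close>

lemma lookup_scaleR: "Poly_Mapping.lookup (a *\<^sub>R x) i = a * Poly_Mapping.lookup x i"
  for x :: "('a, real) poly_mapping"
proof -
  have "finite {i. a * Poly_Mapping.lookup x i \<noteq> 0}"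
    by (rule finite_subset[OF _ finite_lookup[of x]]) auto
  then show ?thesis by (simp add: scaleR_poly_mapping_def)
qed

text \<open>Truncation at \<open>r\<close> guarantees the finite support on which
  \<open>Abs_poly_mapping\<close> is meaningful, whatever \<open>c\<close> does beyond
  \<open>r\<close>.\<close>

definition pvec :: "nat \<Rightarrow> (nat \<Rightarrow> real) \<Rightarrow> (nat, real) poly_mapping" where
  "pvec r c = Abs_poly_mapping (\<lambda>i. if i < r then c i else 0)"

lemma lookup_pvec: "Poly_Mapping.lookup (pvec r c) i = (if i < r then c i else 0)"
  by (simp add: pvec_def)

text \<open>The rank is the number of generators, a value that depends on the foliation and cannot
  be part of the type; hence R^r is taken inside the space of finitely supported sequences.\<close>

definition trivial_bundle :: "nat \<Rightarrow> ('m, (nat, real) poly_mapping) vbundle" where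
  "trivial_bundle r = \<lparr>fibre = \<lambda>p. {x. Poly_Mapping.lookup x \<in> coord_space r},
     trivs = {(UNIV, r, \<lambda>p. Poly_Mapping.lookup)}\<rparr>"

definition span_anchor ::
  "nat \<Rightarrow> (nat \<Rightarrow> 'm vfield) \<Rightarrow> 'm \<Rightarrow> (nat, real) poly_mapping \<Rightarrow> 'm tvec" where
  "span_anchor r X p x = (\<lambda>f. \<Sum>i<r. Poly_Mapping.lookup x i * X i p f)"

text \<open>The formula forced by the Leibniz rule in both arguments once the bracket of the frame
  elements a and b has the components \<open>C a b c\<close>.\<close>

definition span_bracket ::
  "nat \<Rightarrow> (nat \<Rightarrow> 'm vfield) \<Rightarrow> (nat \<Rightarrow> nat \<Rightarrow> nat \<Rightarrow> 'm \<Rightarrow> real) \<Rightarrow>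
   ('m \<Rightarrow> (nat, real) poly_mapping) \<Rightarrow> ('m \<Rightarrow> (nat, real) poly_mapping) \<Rightarrow> 'm \<Rightarrow> (nat, real) poly_mapping" where
  "span_bracket r X C s t = (\<lambda>p. pvec r (\<lambda>c.
     anchor_on (span_anchor r X) s p (\<lambda>q. Poly_Mapping.lookup (t q) c)
     - anchor_on (span_anchor r X) t p (\<lambda>q. Poly_Mapping.lookup (s q) c)
     + (\<Sum>a<r. \<Sum>b<r. Poly_Mapping.lookup (s p) a * Poly_Mapping.lookup (t p) b * C a b c p)))"

lemma span_anchor_lincomb:
  "span_anchor r X p (a *\<^sub>R x + b *\<^sub>R y) = (\<lambda>f. a * span_anchor r X p x f + b * span_anchor r X p y f)"
  by (simp add: span_anchor_def lookup_add lookup_scaleR sum.distrib sum_distrib_left algebra_simps)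

text \<open>Isolates the exchange of sums behind compatibility of bracket and anchor, at one point
  and for one test function h: \<open>xt a c\<close> stands for X_a applied to the c-th coordinate
  of t, \<open>ts c\<close> for the anchor image of t applied to the c-th coordinate of s, and
  \<open>x c\<close> for X_c h.\<close>

lemma bracket_sum_identity:
  fixes s t ts x :: "nat \<Rightarrow> real"
  shows "(\<Sum>c<r. ((\<Sum>a<r. s a * xt a c) - ts c + (\<Sum>a<r. \<Sum>b<r. s a * t b * C a b c)) * x c) =
    (\<Sum>a<r. s a * (\<Sum>b<r. xt a b * x b + t b * (\<Sum>c<r. C a b c * x c)) - ts a * x a)"
proof -
  have 1: "(\<Sum>c<r. (\<Sum>a<r. s a * xt a c) * x c) = (\<Sum>a<r. s a * (\<Sum>b<r. xt a b * x b))"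
    unfolding sum_distrib_left sum_distrib_right by (subst sum.swap) (simp add: mult.assoc)
  have "(\<Sum>c<r. (\<Sum>a<r. \<Sum>b<r. s a * t b * C a b c) * x c)
      = (\<Sum>c<r. \<Sum>a<r. \<Sum>b<r. s a * t b * C a b c * x c)"
    unfolding sum_distrib_right ..
  also have "\<dots> = (\<Sum>a<r. \<Sum>c<r. \<Sum>b<r. s a * t b * C a b c * x c)"
    by (rule sum.swap)
  also have "\<dots> = (\<Sum>a<r. \<Sum>b<r. \<Sum>c<r. s a * t b * C a b c * x c)"
    by (rule sum.cong[OF refl], rule sum.swap)
  also have "\<dots> = (\<Sum>a<r. s a * (\<Sum>b<r. t b * (\<Sum>c<r. C a b c * x c)))"
    unfolding sum_distrib_left by (simp add: mult.assoc)
  finally have 2: "(\<Sum>c<r. (\<Sum>a<r. \<Sum>b<r. s a * t b * C a b c) * x c)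
      = (\<Sum>a<r. s a * (\<Sum>b<r. t b * (\<Sum>c<r. C a b c * x c)))" .
  show ?thesis
    unfolding distrib_right left_diff_distrib sum.distrib sum_subtractf distrib_left 1 2 by simp
qed

context smooth_manifold
begin

lemma trivial_bundle_vector_bundle: "vector_bundle At (trivial_bundle r :: ('m, _) vbundle)"
proof -
  have sub: "subspace {x :: (nat, real) poly_mapping. Poly_Mapping.lookup x \<in> coord_space r}"
    by (simp add: subspace_def coord_space_def lookup_add lookup_scaleR)
  have bij: "bij_betw Poly_Mapping.lookup
      {x :: (nat, real) poly_mapping. Poly_Mapping.lookup x \<in> coord_space r} (coord_space r)"
  proof (rule bij_betw_imageI)
    show "inj_on Poly_Mapping.lookup {x :: (nat, real) poly_mapping. Poly_Mapping.lookup x \<in> coord_space r}"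
      by (rule inj_onI) (rule poly_mapping_eqI, simp)
    show "Poly_Mapping.lookup ` {x :: (nat, real) poly_mapping. Poly_Mapping.lookup x \<in> coord_space r}
        = coord_space r"
    proof (intro equalityI subsetI)
      fix c assume "c \<in> Poly_Mapping.lookup ` {x :: (nat, real) poly_mapping. Poly_Mapping.lookup x \<in> coord_space r}"
      then show "c \<in> coord_space r" by (elim imageE) (simp only: mem_Collect_eq)
    next
      fix c assume c: "c \<in> coord_space r"
      have "c = Poly_Mapping.lookup (pvec r c)"
      proof
        show "c i = Poly_Mapping.lookup (pvec r c) i" for i
          using c by (cases "i < r") (simp_all add: lookup_pvec coord_space_def)
      qed
      moreover from this c have "pvec r c \<in> {x. Poly_Mapping.lookup x \<in> coord_space r}"
        by (simp only: mem_Collect_eq)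
      ultimately show "c \<in> Poly_Mapping.lookup `
          {x :: (nat, real) poly_mapping. Poly_Mapping.lookup x \<in> coord_space r}"
        by (rule image_eqI)
    qed
  qed
  have delta: "Poly_Mapping.lookup x j = (\<Sum>i<r. (if i = j then 1 else 0) * Poly_Mapping.lookup x i)"
    if "j < r" for j and x :: "(nat, real) poly_mapping"
    using that by (simp only: mult_if_delta sum.delta finite_lessThan lessThan_iff if_True)
  have triv: "trivs (trivial_bundle r :: ('m, _) vbundle) = {(UNIV, r, \<lambda>p. Poly_Mapping.lookup)}"
    and fib: "fibre (trivial_bundle r :: ('m, _) vbundle) p = {x. Poly_Mapping.lookup x \<in> coord_space r}" for p
    by (simp_all add: trivial_bundle_def)
  have ball: "(\<forall>x\<in>{a}. Q x) \<longleftrightarrow> Q a" for a :: 'a and Q by simp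
  show ?thesis
    unfolding vector_bundle_def triv fib ball prod.case
  proof (intro conjI)
    show "\<forall>p. subspace {x :: (nat, real) poly_mapping. Poly_Mapping.lookup x \<in> coord_space r}"
      by (rule allI, rule sub)
    show "(\<Union>(U, k, \<phi>)\<in>{(UNIV, r, \<lambda>p. Poly_Mapping.lookup)}. U) = UNIV"
      by simp
    show "open (UNIV :: 'm set)"
      by (rule open_UNIV)
    show "\<forall>p\<in>UNIV. bij_betw Poly_Mapping.lookup {x. Poly_Mapping.lookup x \<in> coord_space r} (coord_space r) \<and>
        (\<forall>x\<in>{x. Poly_Mapping.lookup x \<in> coord_space r}. \<forall>y\<in>{x. Poly_Mapping.lookup x \<in> coord_space r}.
          \<forall>a b i. Poly_Mapping.lookup (a *\<^sub>R x + b *\<^sub>R y) i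
            = a * Poly_Mapping.lookup x i + b * (Poly_Mapping.lookup y i :: real))"
      by (intro ballI conjI allI bij) (simp only: lookup_add lookup_scaleR)
    show "\<exists>\<tau>. (\<forall>j<r. \<forall>i<r. smooth_fun At (UNIV \<inter> UNIV) (\<tau> j i)) \<and> (\<forall>p\<in>UNIV \<inter> UNIV.
        \<forall>x\<in>{x. Poly_Mapping.lookup x \<in> coord_space r}. \<forall>j<r.
          Poly_Mapping.lookup x j = (\<Sum>i<r. \<tau> j i p * Poly_Mapping.lookup x i))"
    proof (intro exI[of _ "\<lambda>j i p. if i = j then 1 else 0"] conjI allI impI ballI)
      show "Poly_Mapping.lookup x j = (\<Sum>i<r. (if i = j then 1 else 0) * Poly_Mapping.lookup x i)"
        if "j < r" for j and x :: "(nat, real) poly_mapping" by (rule delta[OF that])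
    qed (rule smooth_fun_const)
  qed
qed

lemma sections_trivial_iff:
  "s \<in> sections At (trivial_bundle r) \<longleftrightarrow>
    (\<forall>p. Poly_Mapping.lookup (s p) \<in> coord_space r) \<and>
    (\<forall>i<r. smooth_fun At UNIV (\<lambda>p. Poly_Mapping.lookup (s p) i))"
  by (simp add: sections_def trivial_bundle_def)

lemma section_coord_smooth:
  assumes "s \<in> sections At (trivial_bundle r)"
  shows "smooth_fun At UNIV (\<lambda>p. Poly_Mapping.lookup (s p) i)"
proof (cases "i < r")
  case False
  then have "(\<lambda>p. Poly_Mapping.lookup (s p) i) = (\<lambda>p. 0)"
    using assms by (simp add: sections_trivial_iff coord_space_def)
  then show ?thesis by simp
qed (use assms in \<open>simp add: sections_trivial_iff\<close>)

lemma span_anchor_anchor_map: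
  assumes X: "\<And>i. i < r \<Longrightarrow> X i \<in> vfields At UNIV"
  shows "anchor_map At (trivial_bundle r) (span_anchor r X)"
  unfolding anchor_map_def
proof (intro conjI allI ballI)
  show "span_anchor r X p x \<in> tangent_space At p" for p x
    unfolding span_anchor_def by (rule tangent_sum) (rule vfields_tangent_UNIV[OF X])
  show "span_anchor r X p (a *\<^sub>R x + b *\<^sub>R y) = (\<lambda>f. a * span_anchor r X p x f + b * span_anchor r X p y f)"
    for p x y a b by (rule span_anchor_lincomb)
  fix T assume "T \<in> trivs (trivial_bundle r :: ('m, _) vbundle)"
  then have "T = (UNIV, r, \<lambda>p. Poly_Mapping.lookup)"
    by (simp add: trivial_bundle_def)
  then show "case T of (U, k, \<phi>) \<Rightarrow> \<exists>X'. (\<forall>i<k. X' i \<in> vfields At U) \<and>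
      (\<forall>p\<in>U. \<forall>x\<in>fibre (trivial_bundle r) p. span_anchor r X p x = (\<lambda>f. \<Sum>i<k. \<phi> p x i * X' i p f))"
    using X by (simp add: span_anchor_def) (intro exI[of _ X], simp)
qed

text \<open>Coefficient families of compact support are the same as compactly supported sections:
  the support of a section lies in the union of the finitely many coordinate supports, and contains
  each of them.\<close>

lemma span_c_eq_anchor_image:
  "span_c At UNIV r X = anchor_on (span_anchor r X) ` sections_c At (trivial_bundle r)"
proof (intro equalityI subsetI)
  fix V assume "V \<in> span_c At UNIV r X"
  then obtain f where f: "V = (\<lambda>p h. \<Sum>a<r. f a p * X a p h)" "\<forall>a<r. f a \<in> C_inf_c At UNIV"
    by (auto simp: span_c_def)
  define s where "s = (\<lambda>p. pvec r (\<lambda>a. f a p))"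
  have "s \<in> sections At (trivial_bundle r)"
    using f(2) by (simp add: sections_trivial_iff s_def lookup_pvec coord_space_def
        C_inf_c_subset[where U = UNIV])
  moreover have "compact (closure {p. s p \<noteq> 0})"
  proof (rule compact_closure_subset)
    have "{p. s p \<noteq> 0} \<subseteq> (\<Union>a<r. {p. f a p \<noteq> 0})"
      by (auto simp: s_def poly_mapping_eq_iff fun_eq_iff lookup_pvec split: if_splits)
    also have "\<dots> \<subseteq> (\<Union>a<r. closure {p. f a p \<noteq> 0})"
      by (intro UN_mono order_refl closure_subset)
    finally show "{p. s p \<noteq> 0} \<subseteq> (\<Union>a<r. closure {p. f a p \<noteq> 0})" .
    show "compact (\<Union>a<r. closure {p. f a p \<noteq> 0})"
      using f(2) by (intro compact_UN) (simp_all add: C_inf_c_def)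
  qed
  moreover have "V = anchor_on (span_anchor r X) s"
    by (simp add: f(1) s_def anchor_on_def span_anchor_def lookup_pvec)
  ultimately show "V \<in> anchor_on (span_anchor r X) ` sections_c At (trivial_bundle r)"
    by (simp add: sections_c_def)
next
  fix V assume "V \<in> anchor_on (span_anchor r X) ` sections_c At (trivial_bundle r)"
  then obtain s where s: "V = anchor_on (span_anchor r X) s" "s \<in> sections At (trivial_bundle r)"
    "compact (closure {p. s p \<noteq> 0})"
    by (auto simp: sections_c_def)
  have "compact (closure {p. Poly_Mapping.lookup (s p) a \<noteq> 0})" for a
  proof (rule compact_closure_subset[OF _ s(3)])
    have "{p. Poly_Mapping.lookup (s p) a \<noteq> 0} \<subseteq> {p. s p \<noteq> 0}" by auto
    then show "{p. Poly_Mapping.lookup (s p) a \<noteq> 0} \<subseteq> closure {p. s p \<noteq> 0}"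
      using closure_subset by (rule order_trans)
  qed
  then have "\<forall>a<r. (\<lambda>p. Poly_Mapping.lookup (s p) a) \<in> C_inf_c At UNIV"
    using section_coord_smooth[OF s(2)] by (simp add: C_inf_c_def C_inf_iff)
  then show "V \<in> span_c At UNIV r X"
    unfolding span_c_def mem_Collect_eq
    by (intro exI[of _ "\<lambda>a p. Poly_Mapping.lookup (s p) a"] conjI)
       (simp_all add: s(1) anchor_on_def span_anchor_def)
qed

section \<open>Structure functions of the generators\<close>

lemma lie_bracket_skew: "lie_bracket X Y p h = - lie_bracket Y X p h"
  by (simp add: lie_bracket_def)

lemma lie_bracket_local:
  assumes X: "X \<in> vfields At UNIV" and X': "X' \<in> vfields At UNIV" and Y: "Y \<in> vfields At UNIV"
    and U: "open U" "p \<in> U" "\<And>q. q \<in> U \<Longrightarrow> X q = X' q"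
  shows "lie_bracket X Y p = lie_bracket X' Y p"
proof
  fix h
  show "lie_bracket X Y p h = lie_bracket X' Y p h"
  proof (cases "smooth_fun At UNIV h")
    case True
    have "Y p (\<lambda>q. X q h) = Y p (\<lambda>q. X' q h)"
      by (rule tangent_local[OF vfields_tangent_UNIV[OF Y] vfields_smooth[OF X True]
            vfields_smooth[OF X' True] U(1,2)]) (simp add: U(3))
    then show ?thesis by (simp add: lie_bracket_def U(2,3))
  next
    case False
    then show ?thesis
      by (simp add: tangent_nonsmooth[OF vfields_tangent_UNIV[OF lie_bracket_vfields[OF X Y]]]
          tangent_nonsmooth[OF vfields_tangent_UNIV[OF lie_bracket_vfields[OF X' Y]]])
  qed
qed

text \<open>A generator need not have compact support and so need not lie in the foliation, but its
  product with \<open>c\<close> does. The brackets of the products agree with the original ones only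
  where \<open>c\<close> is 1, so everything is multiplied by a bump \<open>b\<close> supported
  there; this makes the expansion an identity on the whole manifold.\<close>

lemma local_structure_functions:
  assumes X: "\<And>i. i < r \<Longrightarrow> X i \<in> vfields At UNIV"
    and F: "singular_foliation At (span_c At UNIV r X)"
  shows "\<exists>b W D. smooth_fun At UNIV b \<and> open W \<and> p \<in> W \<and> (\<forall>q\<in>W. b q = 1) \<and>
    (\<forall>i j k. smooth_fun At UNIV (D i j k)) \<and>
    (\<forall>i<r. \<forall>j<r. \<forall>q h. b q * lie_bracket (X i) (X j) q h = (\<Sum>k<r. D i j k q * X k q h))"
proof -
  obtain c W1 where c: "c \<in> C_inf_c At UNIV" "open W1" "p \<in> W1" "\<And>q. q \<in> W1 \<Longrightarrow> c q = 1"
    by (rule bump[OF open_UNIV UNIV_I]) blast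
  obtain b W where b: "b \<in> C_inf_c At W1" "open W" "p \<in> W" "\<And>q. q \<in> W \<Longrightarrow> b q = 1"
    by (rule bump[OF c(2,3)]) blast
  define cX where "cX = (\<lambda>i q h. c q * X i q h)"
  have zero: "(\<lambda>p. 0) \<in> C_inf_c At UNIV"
    by (simp add: C_inf_c_def C_inf_iff)
  have span: "cX i \<in> span_c At UNIV r X" if i: "i < r" for i
  proof -
    have "cX i = (\<lambda>q h. \<Sum>k<r. (if k = i then c else (\<lambda>p. 0)) q * X k q h)"
      using i by (simp add: cX_def if_distrib[of "\<lambda>f. f _ * _"] cong: if_cong)
    with c(1) zero show ?thesis
      unfolding span_c_def mem_Collect_eq
      by (intro exI[of _ "\<lambda>k. if k = i then c else (\<lambda>p. 0)"] conjI) simp_all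
  qed
  have sub: "span_c At UNIV r X \<subseteq> vfields_c At"
    and closed: "\<forall>V\<in>span_c At UNIV r X. \<forall>W\<in>span_c At UNIV r X. lie_bracket V W \<in> span_c At UNIV r X"
    using F unfolding singular_foliation_def by - (elim conjE, assumption)+
  have vf: "cX i \<in> vfields At UNIV" if "i < r" for i
    using subsetD[OF sub span[OF that]] by (simp add: vfields_c_def)
  define P where "P i j f \<longleftrightarrow> (\<forall>k<r. f k \<in> C_inf_c At UNIV) \<and>
      lie_bracket (cX i) (cX j) = (\<lambda>q h. \<Sum>k<r. f k q * X k q h)" for i j f
  have "\<exists>f. P i j f" if "i < r" "j < r" for i j
  proof -
    have "lie_bracket (cX i) (cX j) \<in> span_c At UNIV r X"
      using closed span[OF that(1)] span[OF that(2)] by simp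
    then show ?thesis
      unfolding span_c_def mem_Collect_eq P_def by (elim exE conjE) (intro exI conjI)
  qed
  then have "\<forall>i j. \<exists>f. i < r \<longrightarrow> j < r \<longrightarrow> P i j f"
    by blast
  then obtain f where "\<forall>i j. i < r \<longrightarrow> j < r \<longrightarrow> P i j (f i j)"
    by metis
  then have f: "(\<forall>k<r. f i j k \<in> C_inf_c At UNIV) \<and>
      lie_bracket (cX i) (cX j) = (\<lambda>q h. \<Sum>k<r. f i j k q * X k q h)" if "i < r" "j < r" for i j
    using that unfolding P_def by simp
  \<comment> \<open>The value 0 outside the index range makes \<open>D\<close> smooth for all
    indices, so gluing needs no side conditions.\<close>
  define D where "D = (\<lambda>i j k q. if i < r \<and> j < r \<and> k < r then b q * f i j k q else 0)"
  have "smooth_fun At UNIV (D i j k)" for i j k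
  proof (cases "i < r \<and> j < r \<and> k < r")
    case True
    then have "smooth_fun At UNIV (f i j k)"
      using f[of i j] by (intro C_inf_c_subset[where U = UNIV]) simp
    then show ?thesis
      using True smooth_fun_mult[OF C_inf_c_subset[OF b(1)]] by (simp add: D_def)
  qed (auto simp: D_def)
  moreover have "b q * lie_bracket (X i) (X j) q h = (\<Sum>k<r. D i j k q * X k q h)"
    if ij: "i < r" "j < r" for i j q h
  proof (cases "q \<in> W1")
    case True
    have eq: "cX i q = X i q" if "q \<in> W1" for i q
      using c(4)[OF that] by (simp add: cX_def)
    \<comment> \<open>The generators are replaced by their cut-offs one at a time: locality is
      available in the first argument, and skew-symmetry moves the other generator there.\<close>
    have "lie_bracket (X i) (X j) q = lie_bracket (cX i) (X j) q"
      by (rule lie_bracket_local[OF X[OF ij(1)] vf[OF ij(1)] X[OF ij(2)] c(2) True]) (simp add: eq)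
    moreover have "lie_bracket (X j) (cX i) q = lie_bracket (cX j) (cX i) q"
      by (rule lie_bracket_local[OF X[OF ij(2)] vf[OF ij(2)] vf[OF ij(1)] c(2) True]) (simp add: eq)
    ultimately have "lie_bracket (X i) (X j) q h = lie_bracket (cX i) (cX j) q h"
      using lie_bracket_skew[of "cX i" "X j" q h] lie_bracket_skew[of "cX i" "cX j" q h] by simp
    then show ?thesis
      using f[OF ij] ij by (simp add: D_def sum_distrib_left mult.assoc)
  next
    case False
    have "b q = 0" by (rule C_inf_c_zero_outside[OF b(1) False])
    moreover from this have "D i j k q = 0" for k by (simp add: D_def)
    ultimately show ?thesis by simp
  qed
  ultimately show ?thesis
    using b C_inf_c_subset[OF b(1)]
    by (intro exI[of _ b] exI[of _ W] exI[of _ D] conjI allI impI ballI) simp_all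
qed

text \<open>The local expansions are glued as linear combinations with total weight 1. Dependent
  generators leave the coefficients ambiguous, so skew-symmetry must be imposed afterwards.\<close>

lemma structure_functions:
  assumes X: "\<And>i. i < r \<Longrightarrow> X i \<in> vfields At UNIV"
    and F: "singular_foliation At (span_c At UNIV r X)"
  obtains C where "\<And>i j k. smooth_fun At UNIV (C i j k)" "\<And>i j k p. C i j k p = - C j i k p"
    "\<And>i j p h. i < r \<Longrightarrow> j < r \<Longrightarrow> lie_bracket (X i) (X j) p h = (\<Sum>k<r. C i j k p * X k p h)"
proof -
  have "\<forall>p. \<exists>b W D. smooth_fun At UNIV b \<and> open W \<and> p \<in> W \<and> (\<forall>q\<in>W. b q = 1) \<and>
    (\<forall>i j k. smooth_fun At UNIV (D i j k)) \<and>
    (\<forall>i<r. \<forall>j<r. \<forall>q h. b q * lie_bracket (X i) (X j) q h = (\<Sum>k<r. D i j k q * X k q h))"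
    using local_structure_functions[OF X F] by (rule allI)
  from choice[OF this] obtain b where "\<forall>p. \<exists>W D. smooth_fun At UNIV (b p) \<and> open W \<and> p \<in> W \<and>
    (\<forall>q\<in>W. b p q = 1) \<and> (\<forall>i j k. smooth_fun At UNIV (D i j k)) \<and>
    (\<forall>i<r. \<forall>j<r. \<forall>q h. b p q * lie_bracket (X i) (X j) q h = (\<Sum>k<r. D i j k q * X k q h))" ..
  from choice[OF this] obtain W where "\<forall>p. \<exists>D. smooth_fun At UNIV (b p) \<and> open (W p) \<and> p \<in> W p \<and>
    (\<forall>q\<in>W p. b p q = 1) \<and> (\<forall>i j k. smooth_fun At UNIV (D i j k)) \<and>
    (\<forall>i<r. \<forall>j<r. \<forall>q h. b p q * lie_bracket (X i) (X j) q h = (\<Sum>k<r. D i j k q * X k q h))" ..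
  from choice[OF this] obtain D where *: "\<forall>p. smooth_fun At UNIV (b p) \<and> open (W p) \<and> p \<in> W p \<and>
    (\<forall>q\<in>W p. b p q = 1) \<and> (\<forall>i j k. smooth_fun At UNIV (D p i j k)) \<and>
    (\<forall>i<r. \<forall>j<r. \<forall>q h. b p q * lie_bracket (X i) (X j) q h = (\<Sum>k<r. D p i j k q * X k q h))" ..
  then have b: "\<And>p. smooth_fun At UNIV (b p)" "\<And>p. open (W p)" "\<And>p. p \<in> W p"
      "\<And>p. \<forall>q\<in>W p. b p q = 1" and D: "\<And>p i j k. smooth_fun At UNIV (D p i j k)"
      "\<And>p i j q h. i < r \<Longrightarrow> j < r \<Longrightarrow>
        b p q * lie_bracket (X i) (X j) q h = (\<Sum>k<r. D p i j k q * X k q h)"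
    by simp_all
  show thesis
  proof (rule partition_of_unity[OF b(1-3) bspec[OF b(4)]])
    fix x :: "nat \<Rightarrow> 'm" and \<psi> :: "nat \<Rightarrow> 'm \<Rightarrow> real" and N :: "'m \<Rightarrow> nat"
    assume \<psi>: "\<And>i. smooth_fun At UNIV (\<psi> i)" "\<And>p. (\<Sum>i<N p. \<psi> i p * b (x i) p) = 1"
      "\<And>i p. N p \<le> i \<Longrightarrow> \<psi> i p = 0" "\<And>p. \<exists>U n. open U \<and> p \<in> U \<and> (\<forall>q\<in>U. N q \<le> n)"
    define C' where "C' = (\<lambda>i j k p. \<Sum>l<N p. \<psi> l p * D (x l) i j k p)"
    \<comment> \<open>Averaging with the negated swapped coefficients preserves the expansion,
      because the Lie bracket is itself skew.\<close>
    define C where "C = (\<lambda>i j k p. 1 / 2 * (C' i j k p - C' j i k p))"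
    have "smooth_fun At UNIV (C' i j k)" for i j k
      unfolding C'_def
    proof (rule smooth_fun_locally_finite_sum[OF open_UNIV])
      show "smooth_fun At UNIV (\<lambda>p. \<psi> l p * D (x l) i j k p)" for l
        by (rule smooth_fun_mult[OF \<psi>(1) D(1)])
      show "\<psi> l p * D (x l) i j k p = 0" if "N p \<le> l" for l p
        by (simp add: \<psi>(3)[OF that])
    qed (rule \<psi>(4))
    then have C: "smooth_fun At UNIV (C i j k)" for i j k
      unfolding C_def by (intro smooth_fun_mult smooth_fun_diff smooth_fun_const)
    have C': "(\<Sum>k<r. C' i j k p * X k p h) = lie_bracket (X i) (X j) p h"
      if ij: "i < r" "j < r" for i j p h
    proof -
      have "(\<Sum>k<r. C' i j k p * X k p h) = (\<Sum>k<r. \<Sum>l<N p. \<psi> l p * D (x l) i j k p * X k p h)"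
        unfolding C'_def sum_distrib_right ..
      also have "\<dots> = (\<Sum>l<N p. \<Sum>k<r. \<psi> l p * D (x l) i j k p * X k p h)"
        by (rule sum.swap)
      also have "\<dots> = (\<Sum>l<N p. \<psi> l p * (\<Sum>k<r. D (x l) i j k p * X k p h))"
        by (simp add: sum_distrib_left mult.assoc)
      also have "\<dots> = (\<Sum>l<N p. \<psi> l p * b (x l) p) * lie_bracket (X i) (X j) p h"
        unfolding D(2)[OF ij, symmetric] by (simp add: sum_distrib_right mult.assoc)
      finally show ?thesis by (simp add: \<psi>(2))
    qed
    show thesis
    proof (rule that[OF C])
      show "C i j k p = - C j i k p" for i j k p
        by (simp add: C_def field_simps)
      show "lie_bracket (X i) (X j) p h = (\<Sum>k<r. C i j k p * X k p h)" if ij: "i < r" "j < r" for i j p h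
      proof -
        have "(\<Sum>k<r. C i j k p * X k p h)
            = 1 / 2 * ((\<Sum>k<r. C' i j k p * X k p h) - (\<Sum>k<r. C' j i k p * X k p h))"
          unfolding C_def sum_subtractf[symmetric] sum_distrib_left by (simp add: algebra_simps)
        then show ?thesis
          using C'[OF ij] C'[OF ij(2,1)] lie_bracket_skew[of "X j" "X i" p h] by simp
      qed
    qed
  qed
qed

section \<open>The bracket on the trivial bundle\<close>

lemma span_bracket_almost_lie_algebroid:
  assumes X: "\<And>i. i < r \<Longrightarrow> X i \<in> vfields At UNIV"
    and C: "\<And>i j k. smooth_fun At UNIV (C i j k)" "\<And>i j k p. C i j k p = - C j i k p"
      "\<And>i j p h. i < r \<Longrightarrow> j < r \<Longrightarrow> lie_bracket (X i) (X j) p h = (\<Sum>k<r. C i j k p * X k p h)"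
  shows "almost_lie_algebroid At (trivial_bundle r) (span_anchor r X) (span_bracket r X C)"
proof -
  let ?\<rho> = "anchor_on (span_anchor r X)" and ?L = Poly_Mapping.lookup
    and ?br = "span_bracket r X C" and ?S = "sections At (trivial_bundle r)"
  note smooth = section_coord_smooth
  have \<rho>: "?\<rho> s \<in> vfields At UNIV" if "s \<in> ?S" for s
    unfolding anchor_on_def span_anchor_def by (intro vfields_sum smooth[OF that] X)
  note \<rho>t = vfields_tangent_UNIV[OF \<rho>]
  have \<rho>_lin: "?\<rho> (\<lambda>q. a *\<^sub>R t q + b *\<^sub>R u q) p f = a * ?\<rho> t p f + b * ?\<rho> u p f" for a b t u p f
    by (simp add: anchor_on_def span_anchor_lincomb)
  have \<rho>_scale: "?\<rho> (\<lambda>q. f q *\<^sub>R t q) p h = f p * ?\<rho> t p h" for f t p h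
    using span_anchor_lincomb[of r X p "f p" "t p" 0 "t p"] by (simp add: anchor_on_def)
  have br: "?br s t \<in> ?S" if s: "s \<in> ?S" and t: "t \<in> ?S" for s t
    unfolding sections_trivial_iff
  proof (intro conjI allI impI)
    show "?L (?br s t p) \<in> coord_space r" for p
      by (simp add: span_bracket_def lookup_pvec coord_space_def)
    fix i assume "i < r"
    then show "smooth_fun At UNIV (\<lambda>p. ?L (?br s t p) i)"
      unfolding span_bracket_def lookup_pvec
      by (simp, intro smooth_fun_add smooth_fun_diff smooth_fun_sum smooth_fun_mult
          vfields_smooth[OF \<rho>[OF s]] vfields_smooth[OF \<rho>[OF t]] smooth[OF s] smooth[OF t] C(1))
  qed
  have skew: "?br s t = (\<lambda>p. - ?br t s p)" for s t
  proof (rule ext, rule poly_mapping_eqI)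
    fix p c
    have "(\<Sum>a<r. \<Sum>b<r. ?L (t p) a * ?L (s p) b * C a b c p)
        = (\<Sum>b<r. \<Sum>a<r. ?L (t p) a * ?L (s p) b * C a b c p)"
      by (rule sum.swap)
    also have "\<dots> = - (\<Sum>a<r. \<Sum>b<r. ?L (s p) a * ?L (t p) b * C a b c p)"
      unfolding sum_negf[symmetric]
      by (intro sum.cong refl, subst C(2)) (simp add: mult_ac)
    finally show "?L (?br s t p) c = ?L (- ?br t s p) c"
      by (simp add: span_bracket_def lookup_pvec)
  qed
  have lin: "?br s (\<lambda>p. a *\<^sub>R t p + b *\<^sub>R u p) = (\<lambda>p. a *\<^sub>R ?br s t p + b *\<^sub>R ?br s u p)"
    if s: "s \<in> ?S" and t: "t \<in> ?S" and u: "u \<in> ?S" for s t u a b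
  proof (rule ext, rule poly_mapping_eqI)
    fix p c
    have "?\<rho> s p (\<lambda>q. a * ?L (t q) c + b * ?L (u q) c)
        = a * ?\<rho> s p (\<lambda>q. ?L (t q) c) + b * ?\<rho> s p (\<lambda>q. ?L (u q) c)"
      by (rule tangent_lin[OF \<rho>t[OF s] smooth[OF t] smooth[OF u]])
    then show "?L (?br s (\<lambda>p. a *\<^sub>R t p + b *\<^sub>R u p) p) c = ?L (a *\<^sub>R ?br s t p + b *\<^sub>R ?br s u p) c"
      by (simp add: span_bracket_def lookup_pvec lookup_add lookup_scaleR \<rho>_lin
          sum.distrib sum_distrib_left algebra_simps)
  qed
  have leibniz: "?br s (\<lambda>p. f p *\<^sub>R t p) = (\<lambda>p. ?\<rho> s p f *\<^sub>R t p + f p *\<^sub>R ?br s t p)"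
    if s: "s \<in> ?S" and t: "t \<in> ?S" and f: "smooth_fun At UNIV f" for s t f
  proof (rule ext, rule poly_mapping_eqI)
    fix p c
    have "?\<rho> s p (\<lambda>q. f q * ?L (t q) c) = ?\<rho> s p f * ?L (t p) c + f p * ?\<rho> s p (\<lambda>q. ?L (t q) c)"
      by (rule tangent_mult[OF \<rho>t[OF s] f smooth[OF t]])
    \<comment> \<open>Beyond \<open>r\<close> the left-hand side is 0 by truncation, but the
      right-hand side contains \<open>t p\<close> untruncated, so its coordinates must be known to
      vanish there.\<close>
    moreover have "?L (t p) c = 0" if "\<not> c < r"
      using t that by (simp add: sections_trivial_iff coord_space_def)
    ultimately show "?L (?br s (\<lambda>p. f p *\<^sub>R t p) p) c = ?L (?\<rho> s p f *\<^sub>R t p + f p *\<^sub>R ?br s t p) c"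
      by (simp add: span_bracket_def lookup_pvec lookup_add lookup_scaleR \<rho>_scale
          sum_distrib_left algebra_simps)
  qed
  have bracket: "?\<rho> (?br s t) = lie_bracket (?\<rho> s) (?\<rho> t)" if s: "s \<in> ?S" and t: "t \<in> ?S" for s t
  proof (rule ext, rule ext)
    fix p h
    have exp: "lie_bracket (?\<rho> u) Y p h
        = (\<Sum>a<r. ?L (u p) a * lie_bracket (X a) Y p h - Y p (\<lambda>q. ?L (u q) a) * X a p h)"
      if u: "u \<in> ?S" and Y: "Y \<in> vfields At UNIV" for u Y
    proof -
      have "lie_bracket (?\<rho> u) Y p
          = (\<lambda>h. \<Sum>a<r. ?L (u p) a * lie_bracket (X a) Y p h - Y p (\<lambda>q. ?L (u q) a) * X a p h)"
        by (rule lie_bracket_expansion[OF \<rho>[OF u] Y X smooth[OF u] open_UNIV UNIV_I])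
           (simp_all add: anchor_on_def span_anchor_def)
      then show ?thesis by simp
    qed
    \<comment> \<open>The expansion \<open>exp\<close> acts on the first argument; skew-symmetry
      carries it over to the second, where the structure functions then appear.\<close>
    have 1: "lie_bracket (X a) (?\<rho> t) p h = (\<Sum>b<r. X a p (\<lambda>q. ?L (t q) b) * X b p h
        + ?L (t p) b * (\<Sum>c<r. C a b c p * X c p h))" if a: "a < r" for a
    proof -
      have "lie_bracket (X a) (?\<rho> t) p h
          = - (\<Sum>b<r. ?L (t p) b * lie_bracket (X b) (X a) p h - X a p (\<lambda>q. ?L (t q) b) * X b p h)"
        unfolding lie_bracket_skew[of "X a"] exp[OF t X[OF a]] ..
      also have "\<dots> = (\<Sum>b<r. X a p (\<lambda>q. ?L (t q) b) * X b p h + ?L (t p) b * lie_bracket (X a) (X b) p h)"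
        unfolding sum_negf[symmetric] lie_bracket_skew[of "X a"] by (simp add: algebra_simps)
      finally show ?thesis by (simp add: C(3)[OF a])
    qed
    have "?\<rho> (?br s t) p h = (\<Sum>c<r. ((\<Sum>a<r. ?L (s p) a * X a p (\<lambda>q. ?L (t q) c))
        - ?\<rho> t p (\<lambda>q. ?L (s q) c)
        + (\<Sum>a<r. \<Sum>b<r. ?L (s p) a * ?L (t p) b * C a b c p)) * X c p h)"
      by (simp add: anchor_on_def span_anchor_def span_bracket_def lookup_pvec)
    also have "\<dots> = lie_bracket (?\<rho> s) (?\<rho> t) p h"
      unfolding bracket_sum_identity exp[OF s \<rho>[OF t]] by (simp add: 1)
    finally show "?\<rho> (?br s t) p h = lie_bracket (?\<rho> s) (?\<rho> t) p h" .
  qed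
  have lin': "?br (\<lambda>p. a *\<^sub>R t p + b *\<^sub>R u p) s = (\<lambda>p. a *\<^sub>R ?br t s p + b *\<^sub>R ?br u s p)"
    if "s \<in> ?S" "t \<in> ?S" "u \<in> ?S" for s t u a b
    unfolding skew[of _ s] lin[OF that] by (simp add: algebra_simps)
  show ?thesis
    unfolding almost_lie_algebroid_def
  proof (intro conjI ballI allI)
    fix s t assume s: "s \<in> ?S" and t: "t \<in> ?S"
    show "?br s t \<in> ?S" by (rule br[OF s t])
    show "?br s t = (\<lambda>p. - ?br t s p)" by (rule skew)
    show "?\<rho> (?br s t) = lie_bracket (?\<rho> s) (?\<rho> t)" by (rule bracket[OF s t])
    show "?br s (\<lambda>p. a *\<^sub>R t p + b *\<^sub>R u p) = (\<lambda>p. a *\<^sub>R ?br s t p + b *\<^sub>R ?br s u p)"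
      if "u \<in> ?S" for u a b by (rule lin[OF s t that])
    show "?br (\<lambda>p. a *\<^sub>R t p + b *\<^sub>R u p) s = (\<lambda>p. a *\<^sub>R ?br t s p + b *\<^sub>R ?br u s p)"
      if "u \<in> ?S" for u a b by (rule lin'[OF s t that])
    show "?br s (\<lambda>p. f p *\<^sub>R t p) = (\<lambda>p. ?\<rho> s p f *\<^sub>R t p + f p *\<^sub>R ?br s t p)"
      if "f \<in> C_inf At" for f using that by (intro leibniz[OF s t]) (simp add: C_inf_iff)
  next
    show "vector_bundle At (trivial_bundle r :: ('m, _) vbundle)"
      by (rule trivial_bundle_vector_bundle)
    show "anchor_map At (trivial_bundle r) (span_anchor r X)"
      by (rule span_anchor_anchor_map[OF X])
  qed
qed

end

section \<open>Assembly of the two statements\<close>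

text \<open>Kept polymorphic in the fibre type: statement (ii) uses it at an arbitrary type,
  statement (i) at finitely supported sequences.\<close>

lemma (in riemannian_manifold) almost_lie_algebroid_metric_connection:
  fixes A :: "('m, 'v::real_vector) vbundle"
  assumes "almost_lie_algebroid At A \<rho> br" "module_SRF At g (anchor_on \<rho> ` sections_c At A)"
  shows "\<exists>nab. connection At A nab \<and> metric_parallel At A \<rho> nab g"
proof -
  interpret anchored_bundle At g A \<rho>
    using assms(1) by unfold_locales (simp_all add: almost_lie_algebroid_def)
  show ?thesis by (rule metric_connection_exists[OF assms(2)])
qed

theorem theorem3p6:
  fixes At :: "('m::{t2_space,second_countable_topology}, 'e::{real_inner,heine_borel}) chart set"
    and g :: "'m metric"
  assumes "smooth_atlas At"
    and "riemannian_metric At g"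
  shows "(\<forall>F. module_SRF At g F \<and> finitely_generated At F \<longrightarrow>
            (\<exists>(A :: ('m, (nat, real) poly_mapping) vbundle) \<rho> br nab.
               almost_lie_algebroid At A \<rho> br \<and> connection At A nab \<and>
               F = anchor_on \<rho> ` sections_c At A \<and> metric_parallel At A \<rho> nab g))
       \<and> (\<forall>(A :: ('m, 'v::real_vector) vbundle) \<rho> br.
            almost_lie_algebroid At A \<rho> br \<and> module_SRF At g (anchor_on \<rho> ` sections_c At A) \<longrightarrow>
            (\<exists>nab. connection At A nab \<and> metric_parallel At A \<rho> nab g))"
proof (intro conjI allI impI)
  interpret riemannian_manifold At g
    by unfold_locales (fact assms)+
  show "\<exists>nab. connection At A nab \<and> metric_parallel At A \<rho> nab g"
    if "almost_lie_algebroid At A \<rho> br \<and> module_SRF At g (anchor_on \<rho> ` sections_c At A)"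
    for A :: "('m, 'v) vbundle" and \<rho> br
    using that by (elim conjE) (rule almost_lie_algebroid_metric_connection)
  fix F assume F: "module_SRF At g F \<and> finitely_generated At F"
  then have "\<exists>r X. (\<forall>a<r. X a \<in> vfields At UNIV) \<and> F = span_c At UNIV r X"
    by (simp add: finitely_generated_def)
  then obtain r X where X': "\<forall>a<r. X a \<in> vfields At UNIV" and span: "F = span_c At UNIV r X"
    by (elim exE conjE)
  then have X: "X a \<in> vfields At UNIV" if "a < r" for a
    using that by simp
  have im: "F = anchor_on (span_anchor r X) ` sections_c At (trivial_bundle r)"
    by (simp add: span span_c_eq_anchor_image)
  \<comment> \<open>Rewriting the foliation as the anchor image of compactly supported sections puts
    (i) in the situation of (ii).\<close>
  have SRF: "module_SRF At g (anchor_on (span_anchor r X) ` sections_c At (trivial_bundle r))"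
    using F unfolding im by (rule conjunct1)
  have SF: "singular_foliation At (span_c At UNIV r X)"
    using F by (simp add: module_SRF_def span)
  show "\<exists>(A :: ('m, (nat, real) poly_mapping) vbundle) \<rho> br nab.
      almost_lie_algebroid At A \<rho> br \<and> connection At A nab \<and>
      F = anchor_on \<rho> ` sections_c At A \<and> metric_parallel At A \<rho> nab g"
  proof (rule structure_functions[OF X SF])
    fix C
    assume C: "\<And>i j k. smooth_fun At UNIV (C i j k)" "\<And>i j k p. C i j k p = - C j i k p"
      "\<And>i j p h. i < r \<Longrightarrow> j < r \<Longrightarrow> lie_bracket (X i) (X j) p h = (\<Sum>k<r. C i j k p * X k p h)"
    have A: "almost_lie_algebroid At (trivial_bundle r) (span_anchor r X) (span_bracket r X C)"
      by (rule span_bracket_almost_lie_algebroid[OF X C])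
    from almost_lie_algebroid_metric_connection[OF A SRF] obtain nab where
      "connection At (trivial_bundle r) nab"
      "metric_parallel At (trivial_bundle r) (span_anchor r X) nab g"
      by (elim exE conjE)
    with A im show ?thesis by (intro exI conjI)
  qed
qed

end
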